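(* Let $d\ge1$, let $q_\Phi\ge2$ be an integer, and let $\Phi=\{\phi_a(x)=\frac{x+\mathfrak{p}_a}{q_\Phi}\}_{a\in\mathcal{A}}$ with $\mathfrak{p}_a\in\mathbb{Z}^d$. Let $\Psi:\mathbb{N}\to[0,\infty)$ be non-increasing. Then: \begin{enumerate} \item For any $s\ge0$, if $\sum_{n=1}^\infty n\cdot\#\mathcal{A}^n\cdot\Psi(q_\Phi^n)^s<\infty$, then $\mathcal{H}^s(W^*_\Phi(\Psi))=0$. \item If $\sum_{n=1}^\infty n\cdot\#\mathcal{A}^n\cdot\Psi(q_\Phi^n)^{\log\#\mathcal{A}/\log q_\Phi}=\infty$, then $\mu(W^*_\Phi(\Psi))=1$. \end{enumerate}
   Context: $X$ is the self-similar set of $\Phi$ (the unique non-empty compact set with $X=\bigcup_a\phi_a(X)$), and $\pi:\mathcal{A}^{\mathbb{N}}\to X$, $\pi((a_n))=\sum_{n\ge1}\mathfrak{p}_{a_n}q_\Phi^{-n}$. For a finite word $\mathbf{a}=a_1\cdots a_n$, $|\mathbf{a}|=n$, and $\mathbf{b}^\infty$ denotes the infinite periodic concatenation of $\mathbf{b}$. Every point of $X\cap\mathbb{Q}^d$ is of the form $\pi(a_1\cdots a_l(a_{l+1}\cdots a_n)^\infty)$ for some word $\mathbf{a}$ and $0\le l\le|\mathbf{a}|-1$. For $\mathfrak{p}/q\in X\cap\mathbb{Q}^d$ the intrinsic denominator is $q_{int}(\mathfrak{p}/q)=\inf\{q_\Phi^l(q_\Phi^{|\mathbf{a}|-l}-1):\mathbf{a}\in\bigcup_n\mathcal{A}^n,\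 0\le l\le|\mathbf{a}|-1,\ \mathfrak{p}/q=\pi(a_1\cdots a_l(a_{l+1}\cdots a_{|\mathbf{a}|})^\infty)\}$. Define $W^*_\Phi(\Psi)=\{x\in X:\|x-\mathfrak{p}/q\|<\Psi(q_{int}(\mathfrak{p}/q))\text{ for infinitely many }\mathfrak{p}/q\in X\cap\mathbb{Q}^d\}$. $\mu$ is the self-similar measure $\pi_*\mathfrak{m}$ where $\mathfrak{m}$ is the uniform Bernoulli measure on $\mathcal{A}^{\mathbb{N}}$ (each symbol with probability $1/\#\mathcal{A}$). $\mathcal{H}^s$ is $s$-dimensional Hausdorff measure.
   Formalization: In item 2 it is additionally assumed that the translations p_a are not all equal; otherwise X is a single point, W* is empty and μ(W* )=0 although the series can diverge (e.g. #A=1, Ψ=1). *)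

theory Defs
  imports "HOL-Analysis.Analysis" "HOL-Probability.Probability"
begin

text \<open>
  The alphabet is the finite type \<open>'a\<close>, infinite sequences are functions \<open>nat \<Rightarrow> 'a\<close> indexed from
  0, and finite words are lists over \<open>'a\<close>. An iterated function system is given by the integer
  \<open>q\<close> and the digit map \<open>p\<close>; no separation condition is imposed and digits may repeat.
\<close>

definition ifs_map :: "nat \<Rightarrow> ('a \<Rightarrow> real ^ 'd) \<Rightarrow> 'a \<Rightarrow> real ^ 'd \<Rightarrow> real ^ 'd" where
  "ifs_map q p a x = (x + p a) /\<^sub>R real q"

definition self_similar_set :: "nat \<Rightarrow> ('a \<Rightarrow> real ^ 'd) \<Rightarrow> (real ^ 'd) set" where
  "self_similar_set q p =
     (THE X. X \<noteq> {} \<and> compact X \<and> X = (\<Union>a. ifs_map q p a ` X))"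

text \<open>Since sequences are indexed from 0, the digit \<open>w n\<close> carries the weight \<open>q\<^sup>-\<^sup>(\<^sup>n\<^sup>+\<^sup>1\<^sup>)\<close>.\<close>

definition coding_map :: "nat \<Rightarrow> ('a \<Rightarrow> real ^ 'd) \<Rightarrow> (nat \<Rightarrow> 'a) \<Rightarrow> real ^ 'd" where
  "coding_map q p w = (\<Sum>n. p (w n) /\<^sub>R real q ^ Suc n)"

text \<open>
  The sequence \<open>a\<^sub>1 \<dots> a\<^sub>l (a\<^sub>l\<^sub>+\<^sub>1 \<dots> a\<^sub>n)\<^sup>\<infinity>\<close> for a word \<open>a\<close> of length \<open>n\<close>; only meaningful for \<open>l < n\<close>.
\<close>

definition ev_periodic :: "'a list \<Rightarrow> nat \<Rightarrow> nat \<Rightarrow> 'a" where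
  "ev_periodic a l n = (if n < l then a ! n else a ! (l + (n - l) mod (length a - l)))"

definition rational_points :: "(real ^ 'd) set" where
  "rational_points = {x. \<forall>i. x $ i \<in> \<rat>}"

definition q_int :: "nat \<Rightarrow> ('a \<Rightarrow> real ^ 'd) \<Rightarrow> real ^ 'd \<Rightarrow> nat" where
  "q_int q p x =
     Inf {q ^ l * (q ^ (length a - l) - 1) | a l.
            l < length a \<and> x = coding_map q p (ev_periodic a l)}"

definition W_star :: "nat \<Rightarrow> ('a \<Rightarrow> real ^ 'd) \<Rightarrow> (nat \<Rightarrow> real) \<Rightarrow> (real ^ 'd) set" where
  "W_star q p \<Psi> =
     {x \<in> self_similar_set q p.
        infinite {r \<in> self_similar_set q p \<inter> rational_points. norm (x - r) < \<Psi> (q_int q p r)}}"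

definition self_similar_measure ::
    "nat \<Rightarrow> ('a::finite \<Rightarrow> real ^ 'd) \<Rightarrow> (real ^ 'd) measure" where
  "self_similar_measure q p =
     distr (PiM (UNIV :: nat set) (\<lambda>_. measure_pmf (pmf_of_set (UNIV :: 'a set)))) borel
       (coding_map q p)"

text \<open>
  Hausdorff measure with the usual conventions: the empty set contributes 0 and every nonempty
  set contributes 1 when \<open>s = 0\<close> (in the library \<open>0 powr 0 = 0\<close>). Boundedness of the covering sets
  is required explicitly because \<open>diameter\<close> is unspecified on unbounded sets.
\<close>

definition hausdorff_gauge :: "real \<Rightarrow> 'b::metric_space set \<Rightarrow> ennreal" where
  "hausdorff_gauge s U =
     (if U = {} then 0 else if s = 0 then 1 else ennreal (diameter U powr s))"

definition hausdorff_content :: "real \<Rightarrow> real \<Rightarrow> 'b::metric_space set \<Rightarrow> ennreal" where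
  "hausdorff_content s \<delta> E =
     (INF U \<in> {U :: nat \<Rightarrow> 'b set.
                 E \<subseteq> (\<Union>i. U i) \<and> (\<forall>i. bounded (U i) \<and> diameter (U i) \<le> \<delta>)}.
        \<Sum>i. hausdorff_gauge s (U i))"

definition hausdorff_measure :: "real \<Rightarrow> 'b::metric_space set \<Rightarrow> ennreal" where
  "hausdorff_measure s E = (SUP \<delta> \<in> {0<..}. hausdorff_content s \<delta> E)"

end

theory Submission
  imports Defs
begin

text \<open>
  A rational point of the attractor is coded by an eventually periodic word \<open>a\<^sub>1 \<dots> a\<^sub>l (a\<^sub>l\<^sub>+\<^sub>1 \<dots> a\<^sub>n)\<^sup>\<infinity>\<close>,
  because its tails have bounded denominators and so take finitely many values. There are \<open>n #A\<^sup>n\<close> such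
  codes of length \<open>n\<close>, and the intrinsic denominator lies between \<open>q\<^bsup>n - 1\<^esup>\<close> and \<open>q\<^sup>n\<close> for the optimal code;
  the convergence part is the resulting cover by balls.

  For the divergence part choose \<open>m n\<close> minimal with \<open>C q\<^bsup>-(n + m n)\<^esup> < \<Psi> (q\<^sup>n)\<close>, so that \<open>\<Sum> n #A\<^bsup>-m n\<^esup>\<close> diverges.
  A sequence whose block of length \<open>m n\<close> at position \<open>l < n\<close> recurs at position \<open>n\<close> agrees with a code of
  length \<open>n\<close> up to position \<open>n + m n\<close>, whatever the overlaps of the system are. These recurrence
  events have probability \<open>#A\<^bsup>-m n\<^esup>\<close> and, for well separated \<open>l\<close> and \<open>n\<close>, are pairwise independent
  unless the shifts \<open>n - l\<close> coincide, when the correlation decays geometrically. Hence the variance of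
  the number of events is at most a constant times its mean, and Chebyshev's inequality gives
  infinitely many events almost surely.
\<close>

subsection \<open>Coding and the attractor\<close>

locale integer_ifs =
  fixes q :: nat and p :: "'a::finite \<Rightarrow> real ^ 'd::finite"
  assumes q_ge: "q \<ge> 2" and p_int: "\<And>a i. p a $ i \<in> \<int>"
begin

abbreviation (input) \<phi> :: "'a \<Rightarrow> real ^ 'd \<Rightarrow> real ^ 'd" where "\<phi> \<equiv> ifs_map q p"
abbreviation (input) cod :: "(nat \<Rightarrow> 'a) \<Rightarrow> real ^ 'd" where "cod \<equiv> coding_map q p"

section \<open>Contraction estimates and integrality of tails\<close>

definition bnd :: real where "bnd = (\<Sum>a\<in>UNIV. norm (p a))"

lemma norm_digit_le: "norm (p a) \<le> bnd"
  unfolding bnd_def by (rule member_le_sum) auto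

lemma bnd_nonneg: "0 \<le> bnd"
  by (simp add: bnd_def sum_nonneg)

lemma q_pos: "0 < real q" "real q \<noteq> 0"
  using q_ge by auto

lemma ifs_map_step: "x = \<phi> a y \<longleftrightarrow> y = real q *\<^sub>R x - p a"
  using q_pos by (auto simp: ifs_map_def)

lemma norm_ifs_map_diff: "norm (\<phi> a x - \<phi> a y) = norm (x - y) / real q"
proof -
  have "\<phi> a x - \<phi> a y = (x - y) /\<^sub>R real q"
    by (simp add: ifs_map_def algebra_simps)
  then show ?thesis by (simp add: divide_inverse)
qed

lemma ifs_map_in_cball:
  assumes "norm x \<le> bnd" shows "norm (\<phi> a x) \<le> bnd"
proof -
  have "norm (x + p a) \<le> bnd + bnd"
    using norm_triangle_ineq[of x "p a"] norm_digit_le[of a] assms by linarith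
  also have "\<dots> \<le> real q * bnd"
    using mult_right_mono[of 2 "real q" bnd] q_ge bnd_nonneg by auto
  finally have "norm (x + p a) / real q \<le> bnd"
    using q_pos by (simp add: field_simps)
  then show ?thesis
    by (simp add: ifs_map_def divide_inverse mult.commute del: scaleR_right_distrib)
qed

lemma summable_coding: "summable (\<lambda>n. p (w n) /\<^sub>R real q ^ Suc n)"
proof (rule summable_comparison_test')
  show "summable (\<lambda>n. bnd * (1 / real q) ^ n)"
    using q_ge by (intro summable_mult summable_geometric) auto
  show "norm (p (w n) /\<^sub>R real q ^ Suc n) \<le> bnd * (1 / real q) ^ n" for n
  proof -
    have "norm (p (w n) /\<^sub>R real q ^ Suc n) = norm (p (w n)) * inverse (real q ^ Suc n)"
      by simp
    also have "\<dots> \<le> bnd * inverse (real q ^ n)"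
      using q_ge norm_digit_le[of "w n"] bnd_nonneg q_pos
      by (intro mult_mono le_imp_inverse_le) (auto simp: field_simps)
    finally show ?thesis by (simp add: field_simps)
  qed
qed

lemma coding_step: "cod w = \<phi> (w 0) (cod (\<lambda>n. w (Suc n)))"
proof -
  have "cod w = p (w 0) /\<^sub>R real q + (\<Sum>n. p (w (Suc n)) /\<^sub>R real q ^ Suc (Suc n))"
    unfolding coding_map_def using suminf_split_head[OF summable_coding[of w]]
    by (simp add: algebra_simps)
  also have "(\<Sum>n. p (w (Suc n)) /\<^sub>R real q ^ Suc (Suc n))
      = (\<Sum>n. p (w (Suc n)) /\<^sub>R real q ^ Suc n) /\<^sub>R real q"
    using suminf_scaleR_right[OF summable_coding[of "\<lambda>n. w (Suc n)"], of "inverse (real q)"]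
    by (simp add: algebra_simps)
  finally show ?thesis
    by (simp add: ifs_map_def coding_map_def algebra_simps)
qed

lemma coding_tail_step: "cod (\<lambda>i. w (i + k)) = \<phi> (w k) (cod (\<lambda>i. w (i + Suc k)))"
  using coding_step[of "\<lambda>i. w (i + k)"] by simp

lemma norm_coding_le: "norm (cod w) \<le> bnd"
proof -
  have q1: "\<bar>1 / real q\<bar> < 1" using q_ge by auto
  have s: "(\<lambda>n. (bnd / q) * (1 / real q) ^ n) sums ((bnd / q) * (1 / (1 - 1 / real q)))"
    using geometric_sums[of "1 / real q"] q1 by (intro sums_mult) auto
  have "norm (cod w) \<le> (\<Sum>n. (bnd / q) * (1 / real q) ^ n)"
    unfolding coding_map_def
  proof (rule norm_suminf_le)
    show "summable (\<lambda>n. (bnd / q) * (1 / real q) ^ n)" using s sums_summable by blast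
    show "norm (p (w n) /\<^sub>R real q ^ Suc n) \<le> (bnd / q) * (1 / real q) ^ n" for n
      using norm_digit_le[of "w n"] q_pos by (simp add: field_simps)
  qed
  also have "\<dots> = bnd / (real q - 1)"
    using sums_unique[OF s] q_ge by (simp add: field_simps)
  also have "\<dots> \<le> bnd"
    using q_ge bnd_nonneg mult_left_mono[of 1 "real q - 1" bnd] by (simp add: field_simps)
  finally show ?thesis .
qed

text \<open>Agreeing first letters mean a common first map, so every stripped letter gains a factor
  \<open>1 / q\<close>. What remains are two points of the ball of radius
  \<open>bnd\<close>.\<close>

lemma coding_agree:
  "(\<And>i. i < k \<Longrightarrow> w i = v i) \<Longrightarrow> norm (cod w - cod v) \<le> 2 * bnd / real q ^ k"
proof (induction k arbitrary: w v)
  case 0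
  then show ?case
    using norm_triangle_ineq4[of "cod w" "cod v"] norm_coding_le[of w] norm_coding_le[of v]
    by auto
next
  case (Suc k)
  have "norm (cod w - cod v) = norm (cod (\<lambda>n. w (Suc n)) - cod (\<lambda>n. v (Suc n))) / real q"
    using coding_step[of w] coding_step[of v] Suc.prems[of 0] norm_ifs_map_diff by simp
  also have "\<dots> \<le> (2 * bnd / real q ^ k) / real q"
    using q_pos by (intro divide_right_mono Suc.IH Suc.prems) auto
  finally show ?case by (simp add: mult.commute)
qed

text \<open>Each shift multiplies by \<open>q\<close> and subtracts an integer digit. Consequently
  all tails of a rational point share its denominator.\<close>

lemma coding_tail_integer:
  "(real q ^ k *\<^sub>R cod w - cod (\<lambda>i. w (i + k))) $ j \<in> \<int>"
proof (induction k)
  case 0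
  then show ?case by simp
next
  case (Suc k)
  have "cod (\<lambda>i. w (i + Suc k)) = real q *\<^sub>R cod (\<lambda>i. w (i + k)) - p (w k)"
    by (rule ifs_map_step[THEN iffD1, OF coding_tail_step])
  then have "cod (\<lambda>i. w (i + Suc k)) $ j = real q * cod (\<lambda>i. w (i + k)) $ j - p (w k) $ j"
    by (simp only: vector_minus_component vector_scaleR_component real_scaleR_def)
  then have "(real q ^ Suc k *\<^sub>R cod w - cod (\<lambda>i. w (i + Suc k))) $ j
      = real q * (real q ^ k *\<^sub>R cod w - cod (\<lambda>i. w (i + k))) $ j + p (w k) $ j"
    by (simp add: algebra_simps)
  then show ?case
    using Suc p_int by (metis Ints_add Ints_mult Ints_of_nat)
qed

text \<open>A bounded backward orbit is determined by its itinerary, because the maps contract.\<close>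

lemma bounded_orbit_eq_coding:
  assumes orbit: "\<And>n. y n = \<phi> (w n) (y (Suc n))" and bounded: "\<And>n. norm (y n) \<le> R"
  shows "y 0 = cod w"
proof -
  have eq: "norm (y 0 - cod w) = norm (y k - cod (\<lambda>i. w (i + k))) / real q ^ k" for k
  proof (induction k)
    case (Suc k)
    have "norm (y k - cod (\<lambda>i. w (i + k))) = norm (y (Suc k) - cod (\<lambda>i. w (i + Suc k))) / real q"
      using orbit[of k] coding_tail_step[of w k] norm_ifs_map_diff by metis
    then show ?case using Suc by (simp add: mult.commute)
  qed simp
  have le: "norm (y 0 - cod w) \<le> (R + bnd) * (1 / real q) ^ k" for k
  proof -
    have "norm (y k - cod (\<lambda>i. w (i + k))) \<le> R + bnd"
      using norm_triangle_ineq4[of "y k" "cod (\<lambda>i. w (i + k))"] bounded[of k]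
        norm_coding_le[of "\<lambda>i. w (i + k)"]
      by linarith
    then show ?thesis unfolding eq[of k] using q_pos by (simp add: field_simps)
  qed
  have "(\<lambda>k. (R + bnd) * (1 / real q) ^ k) \<longlonglongrightarrow> (R + bnd) * 0"
    using q_ge by (intro tendsto_mult tendsto_const LIMSEQ_power_zero) auto
  then have "norm (y 0 - cod w) \<le> (R + bnd) * 0"
    by (rule LIMSEQ_le_const) (use le in auto)
  then show ?thesis by simp
qed

section \<open>The attractor as the range of the coding map\<close>

lemma range_coding_fixed: "range cod = (\<Union>a. \<phi> a ` range cod)"
proof (intro equalityI subsetI)
  fix x assume "x \<in> range cod"
  then show "x \<in> (\<Union>a. \<phi> a ` range cod)" using coding_step by blast
next
  fix x assume "x \<in> (\<Union>a. \<phi> a ` range cod)"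
  then obtain a w where "x = \<phi> a (cod w)" by auto
  then have "x = cod (case_nat a w)" using coding_step[of "case_nat a w"] by simp
  then show "x \<in> range cod" by blast
qed

text \<open>Each point of \<open>Y\<close> has a digit and a preimage in \<open>Y\<close>. Iterating
  such a choice produces a bounded orbit, and its itinerary codes the point.\<close>

lemma bounded_subset_range_coding:
  assumes bdd: "\<And>y. y \<in> Y \<Longrightarrow> norm y \<le> R" and sub: "Y \<subseteq> (\<Union>a. \<phi> a ` Y)"
  shows "Y \<subseteq> range cod"
proof
  fix x assume x: "x \<in> Y"
  have "\<exists>a y'. y \<in> Y \<longrightarrow> y' \<in> Y \<and> y = \<phi> a y'" for y
    using sub by blast
  then obtain a t where at: "\<And>y. y \<in> Y \<Longrightarrow> t y \<in> Y \<and> y = \<phi> (a y) (t y)"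
    by metis
  have mem: "(t ^^ n) x \<in> Y" for n
    using x at by (induction n) auto
  have "(t ^^ 0) x = cod (\<lambda>n. a ((t ^^ n) x))"
    by (rule bounded_orbit_eq_coding[where R = R]) (use mem at bdd in auto)
  then show "x \<in> range cod" by auto
qed

text \<open>Pushing \<open>y\<close> through the first \<open>k\<close> maps named by a sequence
  stays in \<open>Y\<close> and lands within a constant times \<open>1 / q ^ k\<close> of the coded
  point.\<close>

lemma range_coding_subset_closed:
  assumes "closed Y" "y \<in> Y" and sub: "(\<Union>a. \<phi> a ` Y) \<subseteq> Y"
  shows "range cod \<subseteq> Y"
proof
  fix x assume "x \<in> range cod"
  then obtain w where w: "x = cod w" by auto
  have approx: "\<exists>z\<in>Y. norm (z - cod w) \<le> (norm y + bnd) / real q ^ k" for k w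
  proof (induction k arbitrary: w)
    case 0
    show ?case using norm_triangle_ineq4[of y "cod w"] norm_coding_le[of w] assms(2)
      by (intro bexI[of _ y]) auto
  next
    case (Suc k)
    obtain z where z: "z \<in> Y" "norm (z - cod (\<lambda>n. w (Suc n))) \<le> (norm y + bnd) / real q ^ k"
      using Suc by blast
    have "norm (\<phi> (w 0) z - cod w) = norm (z - cod (\<lambda>n. w (Suc n))) / real q"
      by (metis coding_step norm_ifs_map_diff)
    also have "\<dots> \<le> ((norm y + bnd) / real q ^ k) / real q"
      using q_pos z by (intro divide_right_mono) auto
    finally show ?case using z sub by (intro bexI[of _ "\<phi> (w 0) z"]) (auto simp: mult.commute)
  qed
  obtain z where z: "\<And>k. z k \<in> Y" "\<And>k. norm (z k - x) \<le> (norm y + bnd) / real q ^ k"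
    using approx[of w] w by metis
  have "(\<lambda>k. (norm y + bnd) * (1 / real q) ^ k) \<longlonglongrightarrow> (norm y + bnd) * 0"
    using q_ge by (intro tendsto_mult tendsto_const LIMSEQ_power_zero) auto
  then have "(\<lambda>k. (norm y + bnd) / real q ^ k) \<longlonglongrightarrow> 0" by (simp add: power_divide)
  then have "(\<lambda>k. z k - x) \<longlonglongrightarrow> 0"
    by (rule Lim_null_comparison[rotated]) (use z in auto)
  then have "z \<longlonglongrightarrow> x" using LIM_zero_iff by blast
  then show "x \<in> Y" using assms(1) z closed_sequentially by blast
qed

lemma compact_ifs_map_image: "compact K \<Longrightarrow> compact (\<Union>a. \<phi> a ` K)"
  unfolding ifs_map_def
  by (intro compact_UN finite compact_continuous_image continuous_intros)

text \<open>The range is recovered as the intersection of the decreasing compact iterates of an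
  invariant ball, so compactness needs no topology on sequences.\<close>

lemma compact_range_coding: "compact (range cod)"
proof -
  define K where "K n = ((\<lambda>S. \<Union>a. \<phi> a ` S) ^^ n) (cball 0 bnd)" for n
  have KS: "K (Suc n) = (\<Union>a. \<phi> a ` K n)" for n by (simp add: K_def)
  have K0: "K 0 = cball 0 bnd" by (simp add: K_def)
  have comp: "compact (K n)" for n
    by (induction n) (simp_all add: K0 KS compact_ifs_map_image)
  have dec1: "K (Suc n) \<subseteq> K n" for n
  proof (induction n)
    case 0
    show ?case using ifs_map_in_cball by (auto simp: KS K0)
  next
    case (Suc n)
    then show ?case unfolding KS[of "Suc n"] KS[of n] by blast
  qed
  have dec: "K n \<subseteq> K m" if "m \<le> n" for m n
    using lift_Suc_antimono_le[of K, OF dec1 that] .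
  have "(\<Inter>n. K n) \<subseteq> (\<Union>a. \<phi> a ` (\<Inter>n. K n))"
  proof
    fix x assume x: "x \<in> (\<Inter>n. K n)"
    have "\<exists>a. x \<in> \<phi> a ` K n" for n using x KS[of n] by blast
    then obtain a where a: "\<And>n. x \<in> \<phi> (a n) ` K n" by metis
    \<comment> \<open>The digit found at level \<open>n\<close> may vary with \<open>n\<close>. One
      digit occurs at infinitely many levels, and since the sets decrease it serves at every
      level.\<close>
    obtain c where c: "infinite {n. a n = c}"
      using pigeonhole_infinite[of "UNIV :: nat set" a] by auto
    have "x \<in> \<phi> c ` K n" for n
    proof -
      obtain m where "m \<ge> n" "a m = c" using c unfolding infinite_nat_iff_unbounded_le by blast
      then show ?thesis using a[of m] dec[of n m] by blast
    qed
    then have "real q *\<^sub>R x - p c \<in> K n" for n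
      using ifs_map_step by (metis imageE)
    moreover have "x = \<phi> c (real q *\<^sub>R x - p c)"
      by (simp add: ifs_map_step)
    ultimately show "x \<in> (\<Union>a. \<phi> a ` (\<Inter>n. K n))"
      by blast
  qed
  moreover have "norm y \<le> bnd" if "y \<in> (\<Inter>n. K n)" for y
    using that K0 by (metis INT_E UNIV_I mem_cball_0)
  ultimately have "(\<Inter>n. K n) \<subseteq> range cod"
    by (intro bounded_subset_range_coding)
  moreover have "range cod \<subseteq> K n" for n
  proof (induction n)
    case 0
    show ?case using norm_coding_le by (auto simp: K0)
  next
    case (Suc n)
    then show ?case using range_coding_fixed KS[of n] by blast
  qed
  ultimately have "range cod = (\<Inter>n. K n)" by blast
  moreover have "compact (\<Inter>n. K n)"
    using comp by (intro compact_Inter) auto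
  ultimately show ?thesis by simp
qed

text \<open>For uniqueness each half of the fixed-point equation gives one inclusion: one half
  together with boundedness, the other together with closedness.\<close>

lemma self_similar_set_eq: "self_similar_set q p = range cod"
  unfolding self_similar_set_def
proof (rule the_equality)
  show "range cod \<noteq> {} \<and> compact (range cod) \<and> range cod = (\<Union>a. \<phi> a ` range cod)"
    using compact_range_coding range_coding_fixed by blast
next
  fix Y assume Y: "Y \<noteq> {} \<and> compact Y \<and> Y = (\<Union>a. \<phi> a ` Y)"
  obtain R where "\<And>y. y \<in> Y \<Longrightarrow> norm y \<le> R"
    using Y compact_imp_bounded bounded_iff by metis
  then have "Y \<subseteq> range cod"
    using Y by (intro bounded_subset_range_coding) auto
  moreover have "range cod \<subseteq> Y"
    using range_coding_subset_closed Y compact_imp_closed by (metis equals0I order_refl)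
  ultimately show "Y = range cod" by blast
qed

end

subsection \<open>Rational points and intrinsic denominators\<close>

lemma finite_vec_components:
  assumes "finite S" shows "finite {v :: 'b ^ 'n::finite. \<forall>i. v $ i \<in> S}"
proof -
  have "{v :: 'b ^ 'n. \<forall>i. v $ i \<in> S} \<subseteq> vec_lambda ` PiE UNIV (\<lambda>_. S)"
    by (auto intro!: image_eqI[of _ _ "vec_nth _"])
  then show ?thesis
    using assms by (meson finite_PiE finite_class.finite_UNIV finite_imageI finite_subset)
qed

lemma rational_points_common_denominator:
  assumes "x \<in> rational_points"
  obtains N :: nat where "N > 0" "\<And>i. real N * x $ i \<in> \<int>"
proof -
  have "\<exists>n::nat. n > 0 \<and> real n * x $ i \<in> \<int>" for i
  proof -
    have "x $ i \<in> \<rat>" using assms by (simp add: rational_points_def)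
    then obtain m :: int and n :: nat where "n > 0" "x $ i = of_int m / of_nat n"
      by (auto simp: Rats_eq_int_div_nat)
    then show ?thesis by (intro exI[of _ n]) auto
  qed
  then obtain e :: "'a \<Rightarrow> nat" where e: "\<And>i. e i > 0" "\<And>i. real (e i) * x $ i \<in> \<int>"
    by metis
  have "real (\<Prod>i\<in>UNIV. e i) * x $ i \<in> \<int>" for i
  proof -
    have "e i dvd (\<Prod>i\<in>UNIV. e i)" by (rule dvd_prodI) auto
    then obtain k where "(\<Prod>i\<in>UNIV. e i) = k * e i" by (metis dvd_def mult.commute)
    then have "real (\<Prod>i\<in>UNIV. e i) * x $ i = real k * (real (e i) * x $ i)" by simp
    then show ?thesis using e(2) by (metis Ints_mult Ints_of_nat)
  qed
  moreover have "(\<Prod>i\<in>UNIV. e i) > 0" using e(1) by (simp add: prod_pos)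
  ultimately show ?thesis using that by blast
qed

lemma ev_periodic_shift:
  "l < length a \<Longrightarrow> ev_periodic a l (i + length a) = ev_periodic a l (i + l)"
proof -
  assume "l < length a"
  then have "(i + length a - l) mod (length a - l) = i mod (length a - l)"
    by (metis Nat.add_diff_assoc less_imp_le mod_add_self2)
  then show ?thesis using \<open>l < length a\<close> by (simp add: ev_periodic_def)
qed

context integer_ifs
begin

text \<open>The tails at \<open>l\<close> and at \<open>length a\<close> are one period apart and
  code the same point. Subtracting the two integrality relations eliminates it and leaves a linear
  equation for \<open>x\<close>.\<close>

lemma coding_ev_periodic_rational:
  assumes l: "l < length a"
  shows "cod (ev_periodic a l) \<in> rational_points"
proof -
  define x where "x = cod (ev_periodic a l)"
  define y where "y = cod (\<lambda>i. ev_periodic a l (i + l))"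
  have y: "y = cod (\<lambda>i. ev_periodic a l (i + length a))"
    using ev_periodic_shift[OF l] by (simp add: y_def)
  have "x $ j \<in> \<rat>" for j
  proof -
    have "(real q ^ length a *\<^sub>R x - y) $ j - (real q ^ l *\<^sub>R x - y) $ j \<in> \<int>"
      using coding_tail_integer[of "length a" "ev_periodic a l" j]
        coding_tail_integer[of l "ev_periodic a l" j]
      by (intro Ints_diff) (simp_all add: x_def y_def[symmetric] y[symmetric])
    then have "(real q ^ length a - real q ^ l) * x $ j \<in> \<int>"
      by (simp add: algebra_simps)
    moreover have "real q ^ l < real q ^ length a"
      using q_ge l by (intro power_strict_increasing) auto
    ultimately have "((real q ^ length a - real q ^ l) * x $ j) / (real q ^ length a - real q ^ l) \<in> \<rat>"
      by (intro Rats_divide Rats_diff Rats_power Rats_of_nat) (metis Ints_cases Rats_of_int)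
    then show ?thesis using \<open>real q ^ l < real q ^ length a\<close> by simp
  qed
  then show ?thesis by (simp add: rational_points_def x_def)
qed

text \<open>Overlaps allow different sequences to code one point, so the hypothesis compares points
  rather than sequences. Read along the periodic itinerary, the tail points still form a bounded
  orbit, which determines the coded point.\<close>

lemma coding_eq_ev_periodic:
  assumes "l < n" and tails: "cod (\<lambda>i. w (i + l)) = cod (\<lambda>i. w (i + n))"
  shows "cod w = cod (ev_periodic (map w [0..<n]) l)"
proof -
  \<comment> \<open>\<open>g k\<close> is the position read at time \<open>k\<close> when reading
    jumps back to \<open>l\<close> instead of reaching \<open>n\<close>.\<close>
  define g where "g k = (if k < l then k else l + (k - l) mod (n - l))" for k
  have g_less: "g k < n" for k
    using assms(1) by (auto simp: g_def) (metis add.commute less_diff_conv mod_less_divisor zero_less_diff)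
  have "ev_periodic (map w [0..<n]) l k = w (g k)" for k
    using g_less[of k] assms(1) by (auto simp: ev_periodic_def g_def)
  then have ev: "ev_periodic (map w [0..<n]) l = (\<lambda>k. w (g k))" ..
  \<comment> \<open>At a jump the true successor is the tail at \<open>n\<close>, which
    \<open>tails\<close> identifies with the one at \<open>l\<close>; at all other times
    \<open>g\<close> simply advances by one.\<close>
  have tail: "cod (\<lambda>i. w (i + g (Suc k))) = cod (\<lambda>i. w (i + Suc (g k)))" for k
  proof (cases "Suc k < l \<or> Suc (g k) \<noteq> n")
    case True
    have "g (Suc k) = Suc (g k)"
    proof (cases "k < l")
      case True
      then show ?thesis using \<open>Suc k < l \<or> Suc (g k) \<noteq> n\<close> by (cases "Suc k < l") (auto simp: g_def)
    next
      case False
      then have "Suc ((k - l) mod (n - l)) \<noteq> n - l"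
        using True \<open>l < n\<close> by (auto simp: g_def)
      then have "Suc (k - l) mod (n - l) = Suc ((k - l) mod (n - l))"
        by (simp add: mod_Suc)
      then show ?thesis using False by (simp add: g_def Suc_diff_le)
    qed
    then show ?thesis by simp
  next
    case False
    have "g (Suc k) = l"
    proof (cases "k < l")
      case True
      then show ?thesis using False by (auto simp: g_def)
    next
      case k: False
      then have "Suc ((k - l) mod (n - l)) = n - l"
        using False \<open>l < n\<close> by (auto simp: g_def)
      then have "Suc (k - l) mod (n - l) = 0" by (simp add: mod_Suc)
      then show ?thesis using k by (simp add: g_def Suc_diff_le)
    qed
    moreover have "Suc (g k) = n" using False by simp
    ultimately show ?thesis using tails by (metis)
  qed
  have "cod (\<lambda>i. w (i + g 0)) = cod (\<lambda>k. w (g k))"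
  proof (rule bounded_orbit_eq_coding)
    show "cod (\<lambda>i. w (i + g k)) = \<phi> (w (g k)) (cod (\<lambda>i. w (i + g (Suc k))))" for k
      unfolding tail by (rule coding_tail_step)
  qed (rule norm_coding_le)
  moreover have "g 0 = 0 \<or> l = 0" by (auto simp: g_def)
  then have "g 0 = 0" by (auto simp: g_def)
  ultimately show ?thesis unfolding ev by simp
qed

lemma rational_point_ev_periodic:
  assumes "x \<in> range cod" "x \<in> rational_points"
  obtains a l where "l < length a" "x = cod (ev_periodic a l)"
proof -
  obtain w where w: "x = cod w" using assms by auto
  obtain N where N: "N > 0" "\<And>i. real N * x $ i \<in> \<int>"
    using rational_points_common_denominator assms by blast
  define S where "S = {k :: real. k \<in> \<int> \<and> \<bar>k\<bar> \<le> real N * bnd}"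
  define T where "T k = cod (\<lambda>i. w (i + k))" for k
  have mem: "real N *\<^sub>R T k \<in> {v. \<forall>i. v $ i \<in> S}" for k
  proof -
    have "real N * T k $ i \<in> \<int>" for i
    proof -
      have "real q ^ k * (real N * x $ i) - real N * (real q ^ k *\<^sub>R cod w - T k) $ i \<in> \<int>"
        by (intro Ints_diff Ints_mult[OF _ N(2)] Ints_mult[OF Ints_of_nat] Ints_power Ints_of_nat)
          (use coding_tail_integer[of k w i] in \<open>simp add: T_def\<close>)
      then show ?thesis by (simp add: w algebra_simps)
    qed
    moreover have "\<bar>real N * T k $ i\<bar> \<le> real N * bnd" for i
      using component_le_norm_cart[of "T k" i] norm_coding_le[of "\<lambda>i. w (i + k)"]
      by (auto simp: T_def abs_mult intro!: mult_left_mono)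
    ultimately show ?thesis by (simp add: S_def)
  qed
  have "finite S" unfolding S_def by (rule finite_abs_int_segment)
  then have "finite (range (\<lambda>k. real N *\<^sub>R T k))"
    using mem by (intro finite_subset[OF _ finite_vec_components]) auto
  then have "\<not> inj (\<lambda>k. real N *\<^sub>R T k)"
    using finite_imageD infinite_UNIV_nat by blast
  then obtain l n where "l \<noteq> n" "real N *\<^sub>R T l = real N *\<^sub>R T n"
    unfolding inj_def by blast
  then obtain l n where "l < n" "real N *\<^sub>R T l = real N *\<^sub>R T n"
    by (metis nat_neq_iff)
  then have "l < n" "T l = T n" using N(1) by auto
  then have "x = cod (ev_periodic (map w [0..<n]) l)"
    unfolding w T_def by (rule coding_eq_ev_periodic)
  then show ?thesis using that[of l "map w [0..<n]"] \<open>l < n\<close> by simp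
qed

lemma q_int_ge:
  assumes "x \<in> range cod" "x \<in> rational_points"
  obtains a l where "l < length a" "x = cod (ev_periodic a l)" "q ^ (length a - 1) \<le> q_int q p x"
proof -
  define S where "S = {q ^ l * (q ^ (length a - l) - 1) | a l. l < length a \<and> x = cod (ev_periodic a l)}"
  obtain b k where "k < length b" "x = cod (ev_periodic b k)"
    by (rule rational_point_ev_periodic[OF assms])
  \<comment> \<open>An infimum of naturals is attained once the set is nonempty, which is where the
    periodic coding of rational points enters.\<close>
  then have "S \<noteq> {}" unfolding S_def by auto
  then have "q_int q p x \<in> S" unfolding q_int_def S_def by (rule Inf_nat_def1)
  then obtain a l where al: "l < length a" "x = cod (ev_periodic a l)"
      "q_int q p x = q ^ l * (q ^ (length a - l) - 1)"
    by (auto simp: S_def)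
  obtain k where k: "length a = l + Suc k" using al(1) by (metis less_iff_Suc_add add_Suc_right)
  have "2 * q ^ k \<le> q * q ^ k" using q_ge by (intro mult_right_mono) auto
  moreover have "1 \<le> q ^ k" using q_ge by auto
  ultimately have "q ^ k \<le> q ^ Suc k - 1" unfolding power_Suc by linarith
  then have "q ^ l * q ^ k \<le> q_int q p x" using al(3) k by simp
  then show ?thesis using that[OF al(1,2)] k by (simp add: power_add)
qed

lemma q_int_le:
  assumes "l < length a" shows "q_int q p (cod (ev_periodic a l)) \<le> q ^ length a"
proof -
  have "q_int q p (cod (ev_periodic a l)) \<le> q ^ l * (q ^ (length a - l) - 1)"
    unfolding q_int_def using assms by (intro cInf_lower) auto
  also have "\<dots> \<le> q ^ l * q ^ (length a - l)" by simp
  also have "\<dots> = q ^ length a" using assms by (simp flip: power_add)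
  finally show ?thesis .
qed

text \<open>\<open>\<Psi>\<close> is monotone only on \<open>{1..}\<close>, so comparing its values
  at intrinsic denominators requires this bound.\<close>

lemma q_int_pos:
  assumes "x \<in> range cod" "x \<in> rational_points" shows "1 \<le> q_int q p x"
proof -
  obtain a :: "'a list" and l where
    "l < length a" "x = cod (ev_periodic a l)" "q ^ (length a - 1) \<le> q_int q p x"
    by (rule q_int_ge[OF assms])
  moreover have "1 \<le> q ^ (length a - 1)" using q_ge by auto
  ultimately show ?thesis by linarith
qed

end

subsection \<open>The convergence part\<close>

text \<open>A ball of radius 0 is empty and has gauge 0, so for \<open>s = 0\<close> the convention
  \<open>0 powr 0 = 0\<close> on the right is the correct one.\<close>

lemma hausdorff_gauge_ball_le:
  fixes x :: "'b::euclidean_space"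
  assumes "0 \<le> s" "0 \<le> \<rho>"
  shows "hausdorff_gauge s (ball x \<rho>) \<le> ennreal (2 powr s * \<rho> powr s)"
proof (cases "\<rho> = 0")
  case True
  then show ?thesis by (simp add: hausdorff_gauge_def)
next
  case False
  then show ?thesis using assms by (auto simp: hausdorff_gauge_def powr_mult)
qed

text \<open>Covers indexed by any countable type become sequences of sets by padding with the empty
  set, whose gauge is 0 even for \<open>s = 0\<close>. Bounds on finite subsums then
  suffice.\<close>

lemma hausdorff_content_le:
  fixes U :: "'i::countable \<Rightarrow> 'b::metric_space set"
  assumes cover: "E \<subseteq> (\<Union>i\<in>I. U i)" and "0 \<le> \<delta>"
    and small: "\<And>i. i \<in> I \<Longrightarrow> bounded (U i) \<and> diameter (U i) \<le> \<delta>"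
    and sums: "\<And>F. finite F \<Longrightarrow> F \<subseteq> I \<Longrightarrow> (\<Sum>i\<in>F. hausdorff_gauge s (U i)) \<le> c"
  shows "hausdorff_content s \<delta> E \<le> c"
proof -
  define V where "V n = (if n \<in> to_nat ` I then U (from_nat n) else {})" for n
  have "E \<subseteq> (\<Union>n. V n)"
  proof
    fix x assume "x \<in> E"
    then obtain i where "i \<in> I" "x \<in> U i" using cover by auto
    then have "x \<in> V (to_nat i)" by (simp add: V_def)
    then show "x \<in> (\<Union>n. V n)" by blast
  qed
  moreover have "\<forall>n. bounded (V n) \<and> diameter (V n) \<le> \<delta>"
    using small \<open>0 \<le> \<delta>\<close> by (auto simp: V_def)
  ultimately have "hausdorff_content s \<delta> E \<le> (\<Sum>n. hausdorff_gauge s (V n))"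
    unfolding hausdorff_content_def by (intro INF_lower) auto
  also have "\<dots> = (SUP k. \<Sum>n<k. hausdorff_gauge s (V n))"
    by (simp add: suminf_eq_SUP)
  also have "\<dots> \<le> c"
  proof (rule SUP_least)
    fix k
    define F where "F = {i \<in> I. to_nat i < k}"
    have "finite (to_nat ` F)" by (rule finite_subset[of _ "{..<k}"]) (auto simp: F_def)
    then have "finite F" by (rule finite_imageD) (metis inj_on_def to_nat_split)
    have "(\<Sum>n<k. hausdorff_gauge s (V n)) = (\<Sum>n\<in>to_nat ` F. hausdorff_gauge s (V n))"
      by (rule sum.mono_neutral_right) (auto simp: F_def V_def hausdorff_gauge_def)
    also have "\<dots> = (\<Sum>i\<in>F. hausdorff_gauge s (U i))"
      by (subst sum.reindex) (auto simp: V_def F_def inj_on_def)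
    also have "\<dots> \<le> c" using sums \<open>finite F\<close> by (simp add: F_def)
    finally show "(\<Sum>n<k. hausdorff_gauge s (V n)) \<le> c" .
  qed
  finally show ?thesis .
qed

locale intrinsic_approximation = integer_ifs q p
  for q :: nat and p :: "'a::finite \<Rightarrow> real ^ 'd::finite" +
  fixes \<Psi> :: "nat \<Rightarrow> real"
  assumes Psi_nonneg: "n \<ge> 1 \<Longrightarrow> \<Psi> n \<ge> 0" and Psi_antimono: "antimono_on {1..} \<Psi>"
begin

lemma Psi_le: "1 \<le> m \<Longrightarrow> m \<le> n \<Longrightarrow> \<Psi> n \<le> \<Psi> m"
  using Psi_antimono by (auto simp: monotone_on_def)

lemma Psi_power_nonneg: "0 \<le> \<Psi> (q ^ n)"
  using q_ge by (intro Psi_nonneg) auto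

text \<open>Only finitely many points have a code of length at most \<open>N\<close>, so among
  infinitely many approximants one has a longer optimal code. Monotonicity then trades its intrinsic
  denominator for \<open>q ^ (length a - 1)\<close>.\<close>

lemma W_star_covered:
  assumes "x \<in> W_star q p \<Psi>"
  obtains a l where "l < length a" "N \<le> length a"
    "norm (x - cod (ev_periodic a l)) < \<Psi> (q ^ (length a - 1))"
proof -
  define R where "R = {r \<in> range cod \<inter> rational_points. norm (x - r) < \<Psi> (q_int q p r)}"
  have inf: "infinite R"
    using assms by (simp add: W_star_def R_def self_similar_set_eq)
  define S where "S = (\<lambda>(a, l). cod (ev_periodic a l)) ` ({a :: 'a list. length a \<le> N} \<times> {..N})"
  have "finite S"
    unfolding S_def using finite_lists_length_le[of "UNIV :: 'a set" N] by auto
  then obtain r where r: "r \<in> R" "r \<notin> S" using inf by (meson finite_subset subsetI)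
  have rX: "r \<in> range cod" "r \<in> rational_points" "norm (x - r) < \<Psi> (q_int q p r)"
    using r by (auto simp: R_def)
  obtain a l where al: "l < length a" "r = cod (ev_periodic a l)" "q ^ (length a - 1) \<le> q_int q p r"
    by (rule q_int_ge[OF rX(1,2)])
  have "N \<le> length a"
  proof (rule ccontr)
    assume "\<not> N \<le> length a"
    then have "(a, l) \<in> {a :: 'a list. length a \<le> N} \<times> {..N}" using al(1) by auto
    then show False using r(2) al(2) by (force simp: S_def)
  qed
  moreover have "\<Psi> (q_int q p r) \<le> \<Psi> (q ^ (length a - 1))"
    using al q_ge by (intro Psi_le) auto
  ultimately show ?thesis using that al rX(3) by auto
qed

text \<open>The terms tend to 0 and their weights are at least 1 for \<open>n \<ge> 1\<close>. For
  \<open>s = 0\<close> this forces \<open>\<Psi> (q ^ n)\<close> to vanish eventually, because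
  \<open>powr\<close> is 1 at every positive base.\<close>

lemma eventually_Psi_power_le:
  assumes s: "0 \<le> s" and sm: "summable (\<lambda>n. real n * real CARD('a) ^ n * \<Psi> (q ^ n) powr s)"
    and "0 < \<delta>"
  shows "\<forall>\<^sub>F n in sequentially. \<Psi> (q ^ n) \<le> \<delta>"
proof -
  have "\<forall>\<^sub>F n in sequentially. real n * real CARD('a) ^ n * \<Psi> (q ^ n) powr s < \<delta> powr s"
    using order_tendstoD(2)[OF summable_LIMSEQ_zero[OF sm]] \<open>0 < \<delta>\<close> by simp
  then show ?thesis using eventually_ge_at_top[of 1]
  proof eventually_elim
    case (elim n)
    show ?case
    proof (rule ccontr)
      assume "\<not> \<Psi> (q ^ n) \<le> \<delta>"
      then have "\<delta> powr s \<le> \<Psi> (q ^ n) powr s"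
        using s \<open>0 < \<delta>\<close> by (intro powr_mono2) auto
      moreover have "1 * 1 \<le> real n * real CARD('a) ^ n"
        using elim by (intro mult_mono one_le_power) (auto simp: Suc_le_eq)
      then have "1 * \<Psi> (q ^ n) powr s \<le> real n * real CARD('a) ^ n * \<Psi> (q ^ n) powr s"
        by (intro mult_right_mono) auto
      ultimately show False using elim by simp
    qed
  qed
qed

text \<open>Codes are grouped by length. The exponent \<open>length a - 1\<close> shifts the series
  by one index, which costs a factor \<open>CARD('a)\<close> and, through
  \<open>Suc n \<le> 2 * n\<close>, a factor 2; \<open>2 powr s\<close> comes from diameters of
  balls.\<close>

lemma gauge_sum_le:
  assumes s: "0 \<le> s" and F: "finite F" "\<And>a l. (a, l) \<in> F \<Longrightarrow> l < length a \<and> Suc N \<le> length a"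
    and N: "1 \<le> N"
    and tail: "\<And>K. (\<Sum>n = N..<K. real n * real CARD('a) ^ n * \<Psi> (q ^ n) powr s) \<le> \<epsilon>"
  shows "(\<Sum>(a, l)\<in>F. hausdorff_gauge s (ball (cod (ev_periodic a l)) (\<Psi> (q ^ (length a - 1)))))
    \<le> ennreal (2 * CARD('a) * 2 powr s * \<epsilon>)"
proof -
  define g where "g n = 2 powr s * \<Psi> (q ^ (n - 1)) powr s" for n
  obtain K where K: "\<And>a l. (a, l) \<in> F \<Longrightarrow> length a < Suc K"
    using finite_imageI[OF F(1), of "\<lambda>(a, l). length a"] unfolding finite_nat_set_iff_bounded
    by (metis (no_types, lifting) case_prod_conv image_eqI less_SucI)
  define G where "G n = {a :: 'a list. length a = n} \<times> {..<n}" for n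
  have finG: "finite (G n)" for n
    unfolding G_def using finite_lists_length_eq[of "UNIV :: 'a set" n] by auto
  have cardG: "card (G n) = CARD('a) ^ n * n" for n
    unfolding G_def using card_lists_length_eq[of "UNIV :: 'a set" n] by (simp add: card_cartesian_product)
  have "(\<Sum>(a, l)\<in>F. hausdorff_gauge s (ball (cod (ev_periodic a l)) (\<Psi> (q ^ (length a - 1)))))
      \<le> (\<Sum>(a, l)\<in>F. ennreal (g (length a)))"
    unfolding g_def using s Psi_power_nonneg by (intro sum_mono) (auto intro!: hausdorff_gauge_ball_le)
  also have "\<dots> \<le> (\<Sum>(a, l)\<in>(\<Union>n\<in>{Suc N..<Suc K}. G n). ennreal (g (length a)))"
    using K F(2) finG by (intro sum_mono2) (fastforce simp: G_def)+
  also have "\<dots> = (\<Sum>n\<in>{Suc N..<Suc K}. \<Sum>(a, l)\<in>G n. ennreal (g (length a)))"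
    using finG by (intro sum.UNION_disjoint) (auto simp: G_def)
  also have "\<dots> = (\<Sum>n\<in>{Suc N..<Suc K}. \<Sum>_\<in>G n. ennreal (g n))"
    by (intro sum.cong) (auto simp: G_def)
  also have "\<dots> = ennreal (\<Sum>n\<in>{Suc N..<Suc K}. real (card (G n)) * g n)"
    by (subst sum_ennreal[symmetric]) (auto simp: g_def ennreal_mult ennreal_of_nat_eq_real_of_nat)
  also have "(\<Sum>n\<in>{Suc N..<Suc K}. real (card (G n)) * g n)
      = (\<Sum>n = N..<K. real (card (G (Suc n))) * g (Suc n))"
    by (rule sum.shift_bounds_Suc_ivl)
  also have "\<dots> \<le> (\<Sum>n = N..<K. (2 * CARD('a) * 2 powr s)
        * (real n * real CARD('a) ^ n * \<Psi> (q ^ n) powr s))"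
  proof (rule sum_mono)
    fix n assume "n \<in> {N..<K}"
    then have "real (Suc n) \<le> 2 * real n" using N by auto
    then have "real (Suc n) * (CARD('a) ^ Suc n * 2 powr s * \<Psi> (q ^ n) powr s)
        \<le> (2 * real n) * (CARD('a) ^ Suc n * 2 powr s * \<Psi> (q ^ n) powr s)"
      by (intro mult_right_mono) auto
    then show "real (card (G (Suc n))) * g (Suc n) \<le> (2 * CARD('a) * 2 powr s)
        * (real n * real CARD('a) ^ n * \<Psi> (q ^ n) powr s)"
      by (simp only: cardG g_def diff_Suc_1 of_nat_mult of_nat_power of_nat_numeral power_Suc mult_ac)
  qed
  also have "\<dots> \<le> 2 * CARD('a) * 2 powr s * \<epsilon>"
    unfolding sum_distrib_left[symmetric] using tail[of K] by (intro mult_left_mono) auto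
  finally show ?thesis by (simp add: ennreal_leI)
qed

theorem hausdorff_measure_W_star_eq_0:
  assumes s: "0 \<le> s" and sm: "summable (\<lambda>n. real n * real CARD('a) ^ n * \<Psi> (q ^ n) powr s)"
  shows "hausdorff_measure s (W_star q p \<Psi>) = 0"
proof -
  define f where "f n = real n * real CARD('a) ^ n * \<Psi> (q ^ n) powr s" for n
  define U where "U = (\<lambda>(a, l). ball (cod (ev_periodic a l)) (\<Psi> (q ^ (length a - 1))))"
  have content_le: "hausdorff_content s \<delta> (W_star q p \<Psi>) \<le> 0 + ennreal \<epsilon>" if "0 < \<delta>" "0 < \<epsilon>" for \<delta> \<epsilon>
  proof -
    define c where "c = 2 * CARD('a) * 2 powr s"
    have "c > 0" by (simp add: c_def)
    have "\<epsilon> / c > 0" using \<open>c > 0\<close> \<open>0 < \<epsilon>\<close> by simp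
    then obtain N1 where N1: "\<And>m n. m \<ge> N1 \<Longrightarrow> norm (sum f {m..<n}) < \<epsilon> / c"
      using sm unfolding f_def[symmetric] summable_Cauchy by blast
    obtain N2 where N2: "\<And>n. n \<ge> N2 \<Longrightarrow> \<Psi> (q ^ n) \<le> \<delta> / 2"
      using eventually_Psi_power_le[OF s sm, of "\<delta> / 2"] \<open>0 < \<delta>\<close>
      by (auto simp: eventually_sequentially)
    \<comment> \<open>\<open>N1\<close> controls the tail of the series, \<open>N2\<close> keeps the
      diameters below \<open>\<delta>\<close>, and 1 permits
      \<open>Suc n \<le> 2 * n\<close>.\<close>
    define N where "N = max 1 (max N1 N2)"
    have "N1 \<le> N" by (simp add: N_def)
    define I where "I = {(a :: 'a list, l). l < length a \<and> Suc N \<le> length a}"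
    show ?thesis
    proof (rule hausdorff_content_le)
      show "W_star q p \<Psi> \<subseteq> (\<Union>i\<in>I. U i)"
      proof
        fix x assume "x \<in> W_star q p \<Psi>"
        then obtain a l where "l < length a" "Suc N \<le> length a"
            "norm (x - cod (ev_periodic a l)) < \<Psi> (q ^ (length a - 1))"
          by (rule W_star_covered)
        then have "(a, l) \<in> I" "x \<in> U (a, l)"
          by (auto simp: I_def U_def dist_norm norm_minus_commute)
        then show "x \<in> (\<Union>i\<in>I. U i)" by blast
      qed
      show "bounded (U i) \<and> diameter (U i) \<le> \<delta>" if "i \<in> I" for i
      proof -
        obtain a l where i: "i = (a, l)" by fastforce
        have "\<Psi> (q ^ (length a - 1)) \<le> \<delta> / 2"
          using that by (intro N2) (auto simp: i I_def N_def)
        then show ?thesis using Psi_power_nonneg \<open>0 < \<delta>\<close> by (simp add: i U_def)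
      qed
      show "(\<Sum>i\<in>F. hausdorff_gauge s (U i)) \<le> 0 + ennreal \<epsilon>" if F: "finite F" "F \<subseteq> I" for F
      proof -
        have "(\<Sum>(a, l)\<in>F. hausdorff_gauge s (ball (cod (ev_periodic a l)) (\<Psi> (q ^ (length a - 1)))))
            \<le> ennreal (2 * CARD('a) * 2 powr s * (\<epsilon> / c))"
        proof (rule gauge_sum_le)
          show "sum (\<lambda>n. real n * real CARD('a) ^ n * \<Psi> (q ^ n) powr s) {N..<K} \<le> \<epsilon> / c" for K
            using N1[of N K, OF \<open>N1 \<le> N\<close>] by (simp add: f_def[symmetric])
        qed (use F s in \<open>auto simp: I_def N_def\<close>)
        moreover have "2 * CARD('a) * 2 powr s * (\<epsilon> / c) = \<epsilon>"
          using \<open>c > 0\<close> unfolding c_def[symmetric] by simp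
        ultimately show ?thesis by (simp add: U_def case_prod_unfold)
      qed
    qed (use \<open>0 < \<delta>\<close> in simp)
  qed
  then have "hausdorff_content s \<delta> (W_star q p \<Psi>) \<le> 0" if "0 < \<delta>" for \<delta>
    by (rule ennreal_le_epsilon) (intro content_le that)
  then show ?thesis
    unfolding hausdorff_measure_def by (intro antisym SUP_least) auto
qed

end

subsection \<open>Repetitions in random sequences\<close>

text \<open>Chebyshev's inequality for the number \<open>X\<close> of events that occur:
  \<open>second\<close> bounds its variance by \<open>c * S\<close>, and if no event occurs,
  \<open>X\<close> deviates from its mean by \<open>S\<close>.\<close>

lemma (in prob_space) prob_no_event_le:
  assumes "finite I" and ev[measurable]: "\<And>i. i \<in> I \<Longrightarrow> E i \<in> events"
    and S_def: "S = (\<Sum>i\<in>I. prob (E i))" and "S > 0"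
    and second: "(\<Sum>i\<in>I. \<Sum>j\<in>I. prob (E i \<inter> E j)) \<le> S\<^sup>2 + c * S"
  shows "prob {x \<in> space M. \<forall>i\<in>I. x \<notin> E i} \<le> c / S"
proof -
  define X where "X x = (\<Sum>i\<in>I. indicator (E i) x :: real)" for x
  have [measurable]: "X \<in> borel_measurable M"
    unfolding X_def by (intro borel_measurable_sum borel_measurable_indicator ev)
  have X2: "(X x)\<^sup>2 = (\<Sum>i\<in>I. \<Sum>j\<in>I. indicator (E i \<inter> E j) x)" for x
    by (simp add: X_def power2_eq_square sum_product indicator_inter_arith)
  have int: "integrable M (indicator A :: _ \<Rightarrow> real)" if "A \<in> events" for A
    using that by (simp add: integrable_indicator_iff less_top[symmetric])
  have intX: "integrable M X"
    unfolding X_def by (intro Bochner_Integration.integrable_sum int ev)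
  have intX2: "integrable M (\<lambda>x. (X x)\<^sup>2)"
    unfolding X2 by (intro Bochner_Integration.integrable_sum int sets.Int ev)
  have EX: "expectation X = S"
    unfolding X_def S_def
    by (subst Bochner_Integration.integral_sum) (auto intro!: int sum.cong ev)
  have "expectation (\<lambda>x. (X x)\<^sup>2) = (\<Sum>i\<in>I. expectation (\<lambda>x. \<Sum>j\<in>I. indicator (E i \<inter> E j) x))"
    unfolding X2
    by (intro Bochner_Integration.integral_sum Bochner_Integration.integrable_sum int sets.Int ev)
  also have "\<dots> = (\<Sum>i\<in>I. \<Sum>j\<in>I. expectation (\<lambda>x. indicator (E i \<inter> E j) x))"
    by (intro sum.cong refl Bochner_Integration.integral_sum int sets.Int ev)
  also have "\<dots> = (\<Sum>i\<in>I. \<Sum>j\<in>I. prob (E i \<inter> E j))"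
    by (intro sum.cong refl) (simp add: ev sets.Int)
  finally have "variance X \<le> c * S"
    using variance_eq[OF intX intX2] EX second by simp
  have "prob {x \<in> space M. \<forall>i\<in>I. x \<notin> E i} \<le> prob {x \<in> space M. \<bar>X x - expectation X\<bar> \<ge> S}"
    using \<open>S > 0\<close> by (intro finite_measure_mono) (auto simp: EX X_def)
  also have "\<dots> \<le> variance X / S\<^sup>2"
    using intX2 \<open>S > 0\<close> by (intro Chebyshev_inequality) auto
  also have "\<dots> \<le> c * S / S\<^sup>2" using \<open>variance X \<le> c * S\<close> by (intro divide_right_mono) auto
  also have "\<dots> = c / S" by (simp add: power2_eq_square)
  finally show ?thesis .
qed

section \<open>The uniform Bernoulli measure and coordinate equalities\<close>

definition uniform_bernoulli :: "(nat \<Rightarrow> 'a::finite) measure" where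
  "uniform_bernoulli = PiM UNIV (\<lambda>_. measure_pmf (pmf_of_set UNIV))"

interpretation letters: sequence_space "measure_pmf (pmf_of_set (UNIV :: 'a::finite set))"
  by (intro sequence_space.intro product_prob_spaceI prob_space_measure_pmf)

interpretation bern: prob_space "uniform_bernoulli :: (nat \<Rightarrow> 'a::finite) measure"
  unfolding uniform_bernoulli_def by (rule letters.P.prob_space_axioms)

lemma space_uniform_bernoulli [simp]: "space uniform_bernoulli = UNIV"
  by (simp add: uniform_bernoulli_def space_PiM)

lemma measurable_coordinate:
  "(\<lambda>w. w i) \<in> measurable uniform_bernoulli (measure_pmf (pmf_of_set (UNIV :: 'a::finite set)))"
  unfolding uniform_bernoulli_def by (rule measurable_component_singleton) simp

lemma sets_coordinate [measurable]: "{w. w i = a} \<in> sets uniform_bernoulli"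
proof -
  have "{w. w i = a} = (\<lambda>w. w i) -` {a} \<inter> space uniform_bernoulli" by auto
  then show ?thesis using measurable_sets[OF measurable_coordinate, of "{a}" i] by simp
qed

lemma sets_coordinate_eq [measurable]: "{w. w i = w j} \<in> sets uniform_bernoulli"
proof -
  have "{w :: nat \<Rightarrow> 'a. w i = w j} = (\<Union>a. {w. w i = a} \<inter> {w. w j = a})" by auto
  also have "\<dots> \<in> sets uniform_bernoulli"
    by (intro sets.finite_UN sets.Int sets_coordinate) auto
  finally show ?thesis .
qed

lemma sets_matching:
  "finite D \<Longrightarrow> {w. \<forall>i\<in>D. w i = w (f i)} \<in> sets uniform_bernoulli"
  using sets.sets_Collect_finite_All[of D uniform_bernoulli "\<lambda>i w. w i = w (f i)"] sets_coordinate_eq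
  by simp

lemma measure_coordinate:
  "measure uniform_bernoulli {w. w i = (a :: 'a::finite)} = 1 / CARD('a)"
proof -
  have "measure_pmf (pmf_of_set (UNIV :: 'a set))
      = distr uniform_bernoulli (measure_pmf (pmf_of_set UNIV)) (\<lambda>w. w i)"
    unfolding uniform_bernoulli_def by (rule letters.PiM_component[symmetric]) simp
  then have "measure (measure_pmf (pmf_of_set (UNIV :: 'a set))) {a} =
      measure uniform_bernoulli ((\<lambda>w. w i) -` {a} \<inter> space uniform_bernoulli)"
    using measurable_coordinate measure_distr by (metis UNIV_I sets_measure_pmf)
  then show ?thesis by (simp add: vimage_def measure_pmf_single)
qed

text \<open>Splicing two independent sequences at position \<open>k\<close> preserves the measure.
  After splicing, \<open>S\<close> concerns only the first sequence and the letter at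
  \<open>k\<close> is the initial letter of the second.\<close>

lemma measure_Int_next_coordinate:
  fixes S :: "(nat \<Rightarrow> 'a::finite) set"
  assumes S: "S \<in> sets uniform_bernoulli"
    and dep: "\<And>w v. (\<And>i. i < k \<Longrightarrow> w i = v i) \<Longrightarrow> w \<in> S \<Longrightarrow> v \<in> S"
  shows "measure uniform_bernoulli (S \<inter> {w. w k = a}) = measure uniform_bernoulli S / CARD('a)"
proof -
  let ?B = "uniform_bernoulli :: (nat \<Rightarrow> 'a) measure"
  let ?c = "\<lambda>(w :: nat \<Rightarrow> 'a, w'). comb_seq k w w'"
  have comb: "distr (?B \<Otimes>\<^sub>M ?B) ?B ?c = ?B"
    unfolding uniform_bernoulli_def by (rule letters.PiM_comb_seq)
  have mc: "?c \<in> measurable (?B \<Otimes>\<^sub>M ?B) ?B"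
    unfolding uniform_bernoulli_def by (rule measurable_comb_seq)
  have "comb_seq k w w' \<in> S \<longleftrightarrow> w \<in> S" for w w'
    using dep[of w "comb_seq k w w'"] dep[of "comb_seq k w w'" w] by (auto simp: comb_seq_def)
  then have vim: "?c -` (S \<inter> {w. w k = a}) \<inter> space (?B \<Otimes>\<^sub>M ?B) = S \<times> {w. w 0 = a}"
    by (auto simp: space_pair_measure comb_seq_def)
  have "emeasure ?B (S \<inter> {w. w k = a}) = emeasure (distr (?B \<Otimes>\<^sub>M ?B) ?B ?c) (S \<inter> {w. w k = a})"
    by (simp only: comb)
  also have "\<dots> = emeasure (?B \<Otimes>\<^sub>M ?B) (S \<times> {w. w 0 = a})"
    using S by (subst emeasure_distr[OF mc]) (auto simp: vim[simplified])
  also have "\<dots> = emeasure ?B S * emeasure ?B {w. w 0 = a}"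
    by (intro bern.emeasure_pair_measure_Times S sets_coordinate)
  finally have "measure ?B (S \<inter> {w. w k = a}) = measure ?B S * measure ?B {w. w 0 = a}"
    by (simp add: measure_def enn2real_mult)
  then show ?thesis by (simp add: measure_coordinate)
qed

text \<open>The constraints define a forest: every \<open>i \<in> D\<close> has the single earlier parent \<open>f i\<close>, so
  exposing the coordinates from left to right every constraint costs exactly one factor.\<close>

lemma measure_matching:
  assumes "finite D" "\<And>i. i \<in> D \<Longrightarrow> f i < i"
  shows "measure uniform_bernoulli {w :: nat \<Rightarrow> 'a::finite. \<forall>i\<in>D. w i = w (f i)} = (1 / CARD('a)) ^ card D"
  using assms
proof (induction D rule: finite_linorder_max_induct)
  case empty
  then show ?case using bern.prob_space by simp
next
  case (insert b D)
  define S where "S = {w :: nat \<Rightarrow> 'a. \<forall>i\<in>D. w i = w (f i)}"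
  \<comment> \<open>Fixing the parent letter turns the new equality into a prescribed letter at
    \<open>b\<close>, a position beyond everything that \<open>T a\<close> depends on.\<close>
  define T where "T a = S \<inter> {w. w (f b) = a}" for a
  have S: "S \<in> sets uniform_bernoulli" unfolding S_def by (intro sets_matching insert)
  have T: "T a \<in> sets uniform_bernoulli" for a
    unfolding T_def by (intro sets.Int S sets_coordinate)
  have less: "i < b" "f i < b" if "i \<in> D" for i
    using insert.hyps(2) insert.prems[of i] that by fastforce+
  have dep: "v \<in> T a" if "\<And>i. i < b \<Longrightarrow> w i = v i" "w \<in> T a" for w v a
    using that less insert.prems[of b] by (auto simp: T_def S_def)
  have "{w :: nat \<Rightarrow> 'a. \<forall>i\<in>insert b D. w i = w (f i)} = (\<Union>a. T a \<inter> {w. w b = a})"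
    by (auto simp: T_def S_def)
  then have "measure uniform_bernoulli {w :: nat \<Rightarrow> 'a. \<forall>i\<in>insert b D. w i = w (f i)}
      = (\<Sum>a\<in>UNIV. measure uniform_bernoulli (T a \<inter> {w. w b = a}))"
    using T by (auto intro!: bern.finite_measure_finite_Union sets.Int sets_coordinate
        simp: disjoint_family_on_def)
  also have "\<dots> = (\<Sum>a\<in>UNIV. measure uniform_bernoulli (T a) / CARD('a))"
    by (intro sum.cong refl measure_Int_next_coordinate T) (rule dep)
  also have "\<dots> = (\<Sum>a\<in>UNIV. measure uniform_bernoulli (T a)) / CARD('a)"
    by (simp add: sum_divide_distrib)
  also have "(\<Sum>a\<in>UNIV. measure uniform_bernoulli (T a)) = measure uniform_bernoulli (\<Union>a. T a)"
    using T by (intro bern.finite_measure_finite_Union[symmetric]) (auto simp: disjoint_family_on_def T_def)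
  also have "(\<Union>a. T a) = S" by (auto simp: T_def)
  also have "measure uniform_bernoulli S = (1 / CARD('a)) ^ card D"
    unfolding S_def using insert by simp
  finally show ?case using insert.hyps less by (auto simp: card_insert_if)
qed

section \<open>Probabilities of single and joint repetitions\<close>

definition repeats :: "nat \<Rightarrow> nat \<Rightarrow> nat \<Rightarrow> (nat \<Rightarrow> 'a) set" where
  "repeats m l n = {w. \<forall>j<m. w (l + j) = w (n + j)}"

text \<open>This is the parent form required by \<open>measure_matching\<close>. It also covers
  \<open>m > n - l\<close>, where a block overlaps its own source.\<close>

lemma repeats_altdef:
  assumes "l < n" shows "repeats m l n = {w. \<forall>i\<in>{n..<n + m}. w i = w (i - (n - l))}"
proof (intro set_eqI iffI)
  fix w :: "nat \<Rightarrow> 'a" assume w: "w \<in> repeats m l n"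
  have "w i = w (i - (n - l))" if "i \<in> {n..<n + m}" for i
  proof -
    have "i - n < m" using that by auto
    then have "w (l + (i - n)) = w (n + (i - n))" using w unfolding repeats_def by blast
    moreover have "l + (i - n) = i - (n - l)" "n + (i - n) = i" using that assms by auto
    ultimately show ?thesis by simp
  qed
  then show "w \<in> {w. \<forall>i\<in>{n..<n + m}. w i = w (i - (n - l))}" by blast
next
  fix w :: "nat \<Rightarrow> 'a" assume w: "w \<in> {w. \<forall>i\<in>{n..<n + m}. w i = w (i - (n - l))}"
  have "w (l + j) = w (n + j)" if "j < m" for j
  proof -
    have "n + j \<in> {n..<n + m}" "n + j - (n - l) = l + j" using assms that by auto
    then show ?thesis using w by (metis (mono_tags, lifting) mem_Collect_eq)
  qed
  then show "w \<in> repeats m l n" by (simp add: repeats_def)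
qed

lemma sets_repeats: "l < n \<Longrightarrow> repeats m l n \<in> sets uniform_bernoulli"
  using sets_matching[of "{n..<n + m}" "\<lambda>i. i - (n - l)"] by (simp add: repeats_altdef)

lemma measure_repeats:
  assumes "l < n"
  shows "measure uniform_bernoulli (repeats m l n :: (nat \<Rightarrow> 'a::finite) set) = (1 / CARD('a)) ^ m"
  unfolding repeats_altdef[OF assms] using assms by (subst measure_matching) auto

text \<open>Disjoint targets give each target position exactly one parent. A source inside the other
  target does no harm, since parents only have to come earlier.\<close>

lemma measure_repeats_Int_disjoint:
  assumes "l < n" "l' < n'" "n + m \<le> n'"
  shows "measure uniform_bernoulli (repeats m l n \<inter> repeats m' l' n' :: (nat \<Rightarrow> 'a::finite) set)
    = (1 / CARD('a)) ^ (m + m')"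
proof -
  define D where "D = {n..<n + m} \<union> {n'..<n' + m'}"
  define f where "f i = (if i < n' then i - (n - l) else i - (n' - l'))" for i
  have "(\<forall>i\<in>{n..<n + m}. w i = w (i - (n - l))) \<longleftrightarrow> (\<forall>i\<in>{n..<n + m}. w i = w (f i))"
       "(\<forall>i\<in>{n'..<n' + m'}. w i = w (i - (n' - l'))) \<longleftrightarrow> (\<forall>i\<in>{n'..<n' + m'}. w i = w (f i))"
    for w :: "nat \<Rightarrow> 'a"
    using assms(3) by (intro ball_cong refl; simp add: f_def)+
  then have "repeats m l n \<inter> repeats m' l' n' = {w :: nat \<Rightarrow> 'a. \<forall>i\<in>D. w i = w (f i)}"
    unfolding repeats_altdef[OF assms(1)] repeats_altdef[OF assms(2)] D_def ball_Un
    by (simp only: Collect_conj_eq)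
  moreover have "f i < i" if "i \<in> D" for i
    using that assms by (auto simp: D_def f_def)
  moreover have "card D = m + m'"
    unfolding D_def using assms(3) by (subst card_Un_disjoint) auto
  moreover have "finite D" by (simp add: D_def)
  ultimately show ?thesis by (simp add: measure_matching)
qed

text \<open>Where the two target blocks overlap, the common letter is copied from two different source
  positions; the resulting constraint between these sources is the one at the positions \<open>D3\<close>, all of
  which precede both targets.\<close>

lemma measure_repeats_Int_overlap:
  assumes "l < n" "l' < n'" "n \<le> n'" "n' < n + m" "l + m \<le> n" "l' + m' \<le> n" and "n - l \<noteq> n' - l'"
  shows "measure uniform_bernoulli (repeats m l n \<inter> repeats m' l' n' :: (nat \<Rightarrow> 'a::finite) set)
    = (1 / CARD('a)) ^ (m + m')"
proof -
  define t t' where "t = n - l" and "t' = n' - l'"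
  define D1 D2 where "D1 = {n..<n + m}" and "D2 = {n'..<n' + m'}"
  define D3 where "D3 = (\<lambda>i. i - min t t') ` (D1 \<inter> D2)"
  define D where "D = D3 \<union> (D1 \<union> D2)"
  \<comment> \<open>Below \<open>n\<close> only positions of \<open>D3\<close> matter: there the
    later source is tied to the earlier one. On the overlap of the targets the parent is that of the
    first repetition.\<close>
  define f where "f i = (if i < n then i - (max t t' - min t t')
     else if i < n + m then i - t else i - t')" for i
  have t: "0 < t" "t \<le> n" "0 < t'" "t' \<le> n'" "t \<noteq> t'"
    using assms by (auto simp: t_def t'_def)
  \<comment> \<open>The separation assumptions put both sources before \<open>n\<close>, hence
    \<open>D3\<close> is disjoint from the targets.\<close>
  have D3_less: "i - min t t' < n" "max t t' \<le> i" if "i \<in> D1 \<inter> D2" for i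
    using that assms by (auto simp: D1_def D2_def t_def t'_def)
  have f3: "f (i - min t t') = i - max t t'" if "i \<in> D1 \<inter> D2" for i
    using D3_less[OF that] by (auto simp: f_def)
  have f1: "f i = i - t" if "i \<in> D1" for i using that by (auto simp: f_def D1_def)
  have f2: "f i = i - t'" if "i \<in> D2" "i \<notin> D1" for i
    using that \<open>n \<le> n'\<close> by (auto simp: f_def D1_def D2_def)
  have "repeats m l n \<inter> repeats m' l' n' = {w :: nat \<Rightarrow> 'a. \<forall>i\<in>D. w i = w (f i)}"
    (is "?L = ?R")
  proof (intro set_eqI iffI)
    fix w :: "nat \<Rightarrow> 'a" assume "w \<in> ?L"
    then have w: "\<And>i. i \<in> D1 \<Longrightarrow> w i = w (i - t)" "\<And>i. i \<in> D2 \<Longrightarrow> w i = w (i - t')"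
      unfolding repeats_altdef[OF assms(1)] repeats_altdef[OF assms(2)] D1_def D2_def t_def t'_def by auto
    have "w i = w (f i)" if "i \<in> D" for i
    proof (cases "i \<in> D3")
      case True
      then obtain k where k: "k \<in> D1 \<inter> D2" "i = k - min t t'" by (auto simp: D3_def)
      then show ?thesis using f3[OF k(1)] w[of k] by (auto simp: min_def max_def)
    next
      case False
      then show ?thesis using w[of i] f1[of i] f2[of i] that by (cases "i \<in> D1") (auto simp: D_def)
    qed
    then show "w \<in> ?R" by blast
  next
    fix w :: "nat \<Rightarrow> 'a" assume "w \<in> ?R"
    then have w: "\<And>i. i \<in> D \<Longrightarrow> w i = w (f i)" by blast
    have w1: "w i = w (i - t)" if "i \<in> D1" for i
      using w[of i] f1[of i] that by (auto simp: D_def)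
    have "w i = w (i - t')" if "i \<in> D2" for i
    proof (cases "i \<in> D1")
      case True
      then have "w (i - min t t') = w (i - max t t')"
        using w[of "i - min t t'"] f3[of i] that by (auto simp: D_def D3_def)
      then show ?thesis using w1[OF True] by (auto simp: min_def max_def split: if_splits)
    next
      case False
      then show ?thesis using w[of i] f2[of i] that by (auto simp: D_def)
    qed
    then show "w \<in> ?L"
      using w1 unfolding repeats_altdef[OF assms(1)] repeats_altdef[OF assms(2)] D1_def D2_def t_def t'_def
      by auto
  qed
  moreover have "f i < i" if "i \<in> D" for i
  proof (cases "i \<in> D3")
    case True
    then obtain k where k: "k \<in> D1 \<inter> D2" "i = k - min t t'" by (auto simp: D3_def)
    have "min t t' < max t t'" using t(5) by auto
    then show ?thesis using f3[OF k(1)] D3_less(2)[OF k(1)] unfolding k(2) by linarith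
  next
    case False
    then show ?thesis using that f1[of i] f2[of i] t assms(3) by (cases "i \<in> D1") (auto simp: D_def D1_def D2_def)
  qed
  \<comment> \<open>The overlap is counted only once in \<open>D1 \<union> D2\<close>; its injective
    shift \<open>D3\<close> restores the missing count.\<close>
  moreover have "card D = m + m'"
  proof -
    have "D3 \<inter> (D1 \<union> D2) = {}"
    proof -
      have "\<forall>i\<in>D3. i < n" using D3_less(1) by (auto simp: D3_def)
      then show ?thesis using assms(3) by (fastforce simp: D1_def D2_def)
    qed
    then have "card D = card D3 + card (D1 \<union> D2)"
      unfolding D_def by (intro card_Un_disjoint) (auto simp: D3_def D1_def D2_def)
    moreover have "inj_on (\<lambda>i. i - min t t') (D1 \<inter> D2)"
    proof (rule inj_onI)
      fix x y assume "x \<in> D1 \<inter> D2" "y \<in> D1 \<inter> D2" "x - min t t' = y - min t t'"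
      then show "x = y" using D3_less(2)[of x] D3_less(2)[of y] by linarith
    qed
    then have "card D3 = card (D1 \<inter> D2)" unfolding D3_def by (rule card_image)
    moreover have "card D1 + card D2 = card (D1 \<union> D2) + card (D1 \<inter> D2)"
      by (intro card_Un_Int) (auto simp: D1_def D2_def)
    ultimately show ?thesis by (simp add: D1_def D2_def)
  qed
  moreover have "finite D" by (simp add: D_def D1_def D2_def D3_def)
  ultimately show ?thesis by (simp add: measure_matching)
qed

text \<open>The product formula can fail only for overlapping targets with equal shifts. Then the
  two repetitions fuse into a single one of length \<open>n' - n + m'\<close>, which gives the
  decaying term.\<close>

lemma measure_repeats_Int_le:
  assumes "l < n" "l' < n'" "n \<le> n'" and sep: "n' < n + m \<Longrightarrow> l + m \<le> n \<and> l' + m' \<le> n"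
  shows "measure uniform_bernoulli (repeats m l n \<inter> repeats m' l' n' :: (nat \<Rightarrow> 'a::finite) set)
    \<le> (1 / CARD('a)) ^ m * (1 / CARD('a)) ^ m'
      + (if n - l = n' - l' then (1 / CARD('a)) ^ (n' - n) * (1 / CARD('a)) ^ m' else 0)"
proof -
  consider "n + m \<le> n'" | "n' < n + m" "n - l \<noteq> n' - l'" | "n' < n + m" "n - l = n' - l'"
    by linarith
  then show ?thesis
  proof cases
    case 1
    then show ?thesis using measure_repeats_Int_disjoint[OF assms(1,2), of m m', where 'a='a]
      by (simp add: power_add)
  next
    case 2
    then show ?thesis using measure_repeats_Int_overlap[OF assms(1-3), of m m', where 'a='a] sep
      by (simp add: power_add)
  next
    case 3
    have l': "l' = l + (n' - n)" using 3 assms by linarith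
    have "repeats m l n \<inter> repeats m' l' n' \<subseteq> (repeats (n' - n + m') l n :: (nat \<Rightarrow> 'a) set)"
    proof
      fix w :: "nat \<Rightarrow> 'a" assume w: "w \<in> repeats m l n \<inter> repeats m' l' n'"
      have "w (l + j) = w (n + j)" if "j < n' - n + m'" for j
      proof (cases "j < n' - n")
        case True
        then show ?thesis using w 3 by (auto simp: repeats_def)
      next
        case False
        then have "j - (n' - n) < m'" using that by linarith
        then have "w (l' + (j - (n' - n))) = w (n' + (j - (n' - n)))"
          using w unfolding repeats_def by blast
        moreover have "l' + (j - (n' - n)) = l + j" "n' + (j - (n' - n)) = n + j"
          using False assms(3) l' by auto
        ultimately show ?thesis by (simp only:)
      qed
      then show "w \<in> repeats (n' - n + m') l n" by (simp add: repeats_def)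
    qed
    then have "measure uniform_bernoulli (repeats m l n \<inter> repeats m' l' n' :: (nat \<Rightarrow> 'a) set)
        \<le> measure uniform_bernoulli (repeats (n' - n + m') l n :: (nat \<Rightarrow> 'a) set)"
      using sets_repeats[OF assms(1)] by (rule bern.finite_measure_mono)
    also have "\<dots> = (1 / CARD('a)) ^ (n' - n) * (1 / CARD('a)) ^ m'"
      by (simp add: measure_repeats[OF assms(1)] power_add)
    finally show ?thesis using 3 by (simp add: add_increasing)
  qed
qed

subsection \<open>Almost sure recurrence\<close>

lemma not_summable_sum_unbounded:
  fixes g :: "nat \<Rightarrow> real"
  assumes "\<And>n. 0 \<le> g n" "\<not> summable g"
  obtains K where "B < sum g {N..<K}"
proof -
  have "\<exists>K. B + sum g {..<N} < sum g {..<K}"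
  proof (rule ccontr)
    assume "\<not> ?thesis"
    then have "sum g {..n} \<le> B + sum g {..<N}" for n
      by (metis lessThan_Suc_atMost not_less)
    then have "summable g" using assms(1) by (intro bounded_imp_summable)
    then show False using assms(2) by simp
  qed
  then obtain K where "B + sum g {..<N} < sum g {..<K}" by blast
  moreover have "sum g {..<K} \<le> sum g ({..<N} \<union> {N..<K})"
    using assms(1) by (intro sum_mono2) auto
  moreover have "sum g ({..<N} \<union> {N..<K}) = sum g {..<N} + sum g {N..<K}"
    by (intro sum.union_disjoint) auto
  ultimately show ?thesis using that[of K] by linarith
qed

lemma summable_mult_power:
  assumes "0 \<le> r" "r < (1 :: real)" shows "summable (\<lambda>n. real n * r ^ n)"
proof (rule summable_comparison_test')
  show "summable (\<lambda>n. of_nat (Suc n) * r ^ n)"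
    using geometric_deriv_sums[of r] assms by (auto simp: sums_iff)
  show "norm (real n * r ^ n) \<le> of_nat (Suc n) * r ^ n" for n
    using assms by (auto simp: abs_mult intro!: mult_right_mono)
qed

text \<open>Discarding the lengths \<open>m n > n / 4\<close>, as well as the sources \<open>l > n / 4\<close> below, keeps all sources
  of two overlapping repetitions to the left of their targets.\<close>

lemma not_summable_short:
  fixes c :: real and m :: "nat \<Rightarrow> nat"
  assumes c: "0 < c" "c < 1" and div: "\<not> summable (\<lambda>n. real n * c ^ m n)"
  shows "\<not> summable (\<lambda>n. if 4 * m n \<le> n then real n * c ^ m n else 0)"
proof
  assume short: "summable (\<lambda>n. if 4 * m n \<le> n then real n * c ^ m n else 0)"
  \<comment> \<open>A discarded term has \<open>4 * m n > n\<close>, so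
    \<open>c ^ m n = r ^ (4 * m n)\<close> is at most \<open>r ^ n\<close>, and these bounds remain
    summable with the weight \<open>n\<close>.\<close>
  define r where "r = root 4 c"
  have r: "0 < r" "r < 1" "r ^ 4 = c" using c by (auto simp: r_def)
  have sm: "summable (\<lambda>n. (if 4 * m n \<le> n then real n * c ^ m n else 0) + real n * r ^ n)"
    using short r by (intro summable_add summable_mult_power) auto
  have "summable (\<lambda>n. real n * c ^ m n)"
  proof (rule summable_comparison_test'[OF sm])
    fix n
    show "norm (real n * c ^ m n) \<le> (if 4 * m n \<le> n then real n * c ^ m n else 0) + real n * r ^ n"
    proof (cases "4 * m n \<le> n")
      case False
      have "c ^ m n = r ^ (4 * m n)" by (simp add: power_mult r(3))
      also have "\<dots> \<le> r ^ n" using r False by (intro power_decreasing) auto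
      finally show ?thesis using False c by (auto intro!: mult_left_mono)
    qed (use c r in auto)
  qed
  then show False using div by simp
qed

text \<open>Equal shifts make \<open>n\<close> determine \<open>l\<close>, so each exponent
  \<open>n' - n\<close> occurs at most once and a geometric series of ratio at most
  \<open>1 / 2\<close> dominates.\<close>

lemma sum_power_diff_le:
  fixes c :: real
  assumes c: "0 \<le> c" "c \<le> 1 / 2" and "finite I"
    and I: "\<And>n l. (n, l) \<in> I \<Longrightarrow> l < n" and "l' < (n' :: nat)"
  shows "(\<Sum>(n, l)\<in>I. if n \<le> n' \<and> n - l = n' - l' then c ^ (n' - n) else 0) \<le> 2"
proof -
  define J where "J = {(n, l) \<in> I. n \<le> n' \<and> n - l = n' - l'}"
  have J: "finite J" using \<open>finite I\<close> by (auto simp: J_def intro: finite_subset[of _ I])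
  have inj: "inj_on (\<lambda>(n, l). n' - n) J"
  proof (rule inj_onI)
    fix x y assume "x \<in> J" "y \<in> J" and eq: "(case x of (n, l) \<Rightarrow> n' - n) = (case y of (n, l) \<Rightarrow> n' - n)"
    obtain a b c d where xy: "x = (a, b)" "y = (c, d)" by fastforce
    have "b < a" "d < c" "a \<le> n'" "c \<le> n'" "a - b = n' - l'" "c - d = n' - l'" "n' - a = n' - c"
      using \<open>x \<in> J\<close> \<open>y \<in> J\<close> eq I by (auto simp: J_def xy)
    then show "x = y" unfolding xy by auto
  qed
  have "(\<Sum>(n, l)\<in>I. if n \<le> n' \<and> n - l = n' - l' then c ^ (n' - n) else 0)
      = (\<Sum>(n, l)\<in>J. c ^ (n' - n))"
    unfolding J_def using \<open>finite I\<close> by (intro sum.mono_neutral_cong_right) (auto split: if_splits)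
  also have "\<dots> = (\<Sum>h\<in>(\<lambda>(n, l). n' - n) ` J. c ^ h)"
    by (subst sum.reindex[OF inj]) (auto simp: case_prod_unfold)
  also have "\<dots> \<le> (\<Sum>h<Suc n'. c ^ h)"
    using c by (intro sum_mono2) auto
  also have "\<dots> \<le> (\<Sum>h<Suc n'. (1 / 2) ^ h)"
    using c by (intro sum_mono power_mono) auto
  also have "\<dots> = 2 * (1 - (1 / 2) ^ Suc n')"
    by (subst sum_gp_strict) auto
  also have "\<dots> \<le> 2" by simp
  finally show ?thesis .
qed

text \<open>Correlations contribute at most 2 times the mean for each order of the pair, so the
  variance is at most 4 times the mean. Keeping only \<open>4 * l \<le> n\<close> retains at least a
  quarter of \<open>S\<close>, whence \<open>16 = 4 * 4\<close>.\<close>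

lemma prob_no_repeats_le:
  fixes m :: "nat \<Rightarrow> nat"
  assumes A: "CARD('a::finite) \<ge> 2"
    and S_def: "S = (\<Sum>n = N..<K. if 4 * m n \<le> n then real n * (1 / CARD('a)) ^ m n else 0)" and "0 < S"
  shows "measure uniform_bernoulli {w :: nat \<Rightarrow> 'a. \<forall>n\<in>{N..<K}. \<forall>l<n. w \<notin> repeats (m n) l n} \<le> 16 / S"
proof -
  define c where "c = 1 / real CARD('a)"
  have c: "0 < c" "c \<le> 1 / 2" using A by (auto simp: c_def field_simps)
  define I where "I = (SIGMA n:{n \<in> {N..<K}. 0 < n \<and> 4 * m n \<le> n}. {l. 4 * l \<le> n})"
  have finl: "finite {l. 4 * l \<le> n}" for n :: nat by (rule finite_subset[of _ "{..n}"]) auto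
  then have "finite I" unfolding I_def by auto
  have I: "l < n" "4 * m n \<le> n" "4 * l \<le> n" "n \<in> {N..<K}" if "(n, l) \<in> I" for n l
    using that by (auto simp: I_def)
  define E where "E = (\<lambda>(n, l). repeats (m n) l n :: (nat \<Rightarrow> 'a) set)"
  have E: "E e \<in> sets uniform_bernoulli" if "e \<in> I" for e
    using that I(1) by (auto simp: E_def intro!: sets_repeats split: prod.splits)
  define P where "P = (\<lambda>(n, l :: nat). c ^ m n)"
  have P: "measure uniform_bernoulli (E e) = P e" if "e \<in> I" for e
    using that I(1) by (auto simp: E_def P_def c_def measure_repeats split: prod.splits)
  have Pnn: "0 \<le> P e" for e using c by (auto simp: P_def split: prod.splits)
  \<comment> \<open>\<open>Q e e'\<close> bounds the excess of the joint probability over the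
    product when the target of \<open>e\<close> comes first.\<close>
  define Q where "Q = (\<lambda>e e'. (case e of (n, l) \<Rightarrow>
      if n \<le> fst e' \<and> n - l = fst e' - snd e' then c ^ (fst e' - n) else 0) * P e')"
  have Qnn: "0 \<le> Q e e'" for e e' using c Pnn by (auto simp: Q_def split: prod.splits)
  have le_ordered: "measure uniform_bernoulli (E e \<inter> E e') \<le> P e * P e' + Q e e'"
    if "e \<in> I" "e' \<in> I" "fst e \<le> fst e'" for e e'
  proof -
    obtain n l n' l' where e: "e = (n, l)" "e' = (n', l')" by fastforce
    \<comment> \<open>Sources and lengths are at most a quarter of their targets. Overlap gives
      \<open>n' < 5 * n / 4\<close>, so even \<open>l' + m n' \<le> n' / 2\<close> stays below
      \<open>n\<close>.\<close>
    have "n' < n + m n \<Longrightarrow> l + m n \<le> n \<and> l' + m n' \<le> n"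
      using I[of n l] I[of n' l'] that e by auto
    then show ?thesis
      using measure_repeats_Int_le[of l n l' n' "m n" "m n'", where 'a='a] I(1)[of n l] I(1)[of n' l'] that
      by (simp add: E_def P_def Q_def e c_def split: if_splits)
  qed
  have le: "measure uniform_bernoulli (E e \<inter> E e') \<le> P e * P e' + (Q e e' + Q e' e)"
    if "e \<in> I" "e' \<in> I" for e e'
    using le_ordered[OF that] le_ordered[OF that(2,1)] Qnn[of e e'] Qnn[of e' e]
    by (cases "fst e \<le> fst e'") (auto simp: Int_commute mult.commute)
  have sumQ: "(\<Sum>e\<in>I. Q e e') \<le> 2 * P e'" if "e' \<in> I" for e'
  proof -
    have "(\<Sum>(n, l)\<in>I. if n \<le> fst e' \<and> n - l = fst e' - snd e' then c ^ (fst e' - n) else 0) \<le> 2"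
      using c I(1) that by (intro sum_power_diff_le \<open>finite I\<close>) (auto simp: I_def)
    then show ?thesis
      unfolding Q_def sum_distrib_right[symmetric] using Pnn by (intro mult_right_mono) (auto simp: case_prod_unfold)
  qed
  define T where "T = (\<Sum>e\<in>I. P e)"
  have T: "T = (\<Sum>e\<in>I. measure uniform_bernoulli (E e))" by (simp add: T_def P)
  have "(\<Sum>e\<in>I. \<Sum>e'\<in>I. measure uniform_bernoulli (E e \<inter> E e'))
      \<le> (\<Sum>e\<in>I. \<Sum>e'\<in>I. P e * P e' + (Q e e' + Q e' e))"
    by (intro sum_mono le)
  also have "\<dots> = T\<^sup>2 + ((\<Sum>e'\<in>I. \<Sum>e\<in>I. Q e e') + (\<Sum>e\<in>I. \<Sum>e'\<in>I. Q e' e))"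
    unfolding sum.distrib T_def power2_eq_square sum_product
    by (subst sum.swap[of Q]) simp
  also have "\<dots> \<le> T\<^sup>2 + ((\<Sum>e'\<in>I. 2 * P e') + (\<Sum>e\<in>I. 2 * P e))"
    by (intro add_left_mono add_mono sum_mono sumQ)
  also have "\<dots> = T\<^sup>2 + 4 * T" by (simp add: T_def sum_distrib_left[symmetric])
  finally have second: "(\<Sum>e\<in>I. \<Sum>e'\<in>I. measure uniform_bernoulli (E e \<inter> E e')) \<le> T\<^sup>2 + 4 * T" .
  have "S / 4 \<le> T"
  proof -
    have "T = (\<Sum>n\<in>{n \<in> {N..<K}. 0 < n \<and> 4 * m n \<le> n}. \<Sum>l | 4 * l \<le> n. c ^ m n)"
      unfolding T_def I_def P_def using finl by (subst sum.Sigma) auto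
    also have "\<dots> \<ge> (\<Sum>n\<in>{n \<in> {N..<K}. 0 < n \<and> 4 * m n \<le> n}. real n * c ^ m n / 4)"
    proof (rule sum_mono)
      fix n :: nat
      have "{l. 4 * l \<le> n} = {..n div 4}" by auto
      then have "card {l. 4 * l \<le> n} = Suc (n div 4)" by simp
      then have "real n / 4 \<le> real (card {l. 4 * l \<le> n})"
        by linarith
      then have "(real n / 4) * c ^ m n \<le> real (card {l. 4 * l \<le> n}) * c ^ m n"
        using c by (intro mult_right_mono) auto
      then show "real n * c ^ m n / 4 \<le> (\<Sum>l | 4 * l \<le> n. c ^ m n)" by simp
    qed
    moreover have "(\<Sum>n\<in>{n \<in> {N..<K}. 0 < n \<and> 4 * m n \<le> n}. real n * c ^ m n / 4) = S / 4"
      unfolding S_def sum_divide_distrib c_def by (intro sum.mono_neutral_cong_left) auto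
    ultimately show ?thesis by simp
  qed
  then have "T > 0" using \<open>S > 0\<close> by simp
  have "measure uniform_bernoulli {w :: nat \<Rightarrow> 'a. \<forall>n\<in>{N..<K}. \<forall>l<n. w \<notin> repeats (m n) l n}
      \<le> measure uniform_bernoulli {w \<in> space uniform_bernoulli. \<forall>e\<in>I. w \<notin> E e}"
  proof (rule bern.finite_measure_mono)
    show "{w \<in> space uniform_bernoulli. \<forall>e\<in>I. w \<notin> E e} \<in> sets uniform_bernoulli"
      using E \<open>finite I\<close> by (intro sets.sets_Collect_finite_All sets.sets_Collect_neg) auto
    show "{w. \<forall>n\<in>{N..<K}. \<forall>l<n. w \<notin> repeats (m n) l n} \<subseteq> {w \<in> space uniform_bernoulli. \<forall>e\<in>I. w \<notin> E e}"
      using I by (auto simp: E_def)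
  qed
  also have "\<dots> \<le> 4 / T"
    by (rule bern.prob_no_event_le[OF \<open>finite I\<close> E T \<open>T > 0\<close> second])
  also have "\<dots> \<le> 4 / (S / 4)"
    using \<open>S / 4 \<le> T\<close> \<open>S > 0\<close> by (intro divide_left_mono) auto
  finally show ?thesis by simp
qed

text \<open>Every tail of the divergent series of short repetitions has unbounded partial sums.
  Widening the window \<open>{N..<K}\<close> therefore drives the probability of no repetition
  beyond \<open>N\<close> to 0.\<close>

theorem AE_infinitely_many_repeats:
  fixes m :: "nat \<Rightarrow> nat"
  assumes A: "CARD('a::finite) \<ge> 2" and div: "\<not> summable (\<lambda>n. real n * (1 / CARD('a)) ^ m n)"
  shows "AE w :: nat \<Rightarrow> 'a in uniform_bernoulli. \<forall>N. \<exists>n\<ge>N. \<exists>l<n. w \<in> repeats (m n) l n"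
proof -
  define g where "g n = (if 4 * m n \<le> n then real n * (1 / CARD('a)) ^ m n else 0)" for n
  have g: "\<not> summable g" "\<And>n. 0 \<le> g n"
    using not_summable_short[OF _ _ div] A by (auto simp: g_def[abs_def])
  have U: "(\<Union>l\<in>{..<n}. repeats (m n) l n :: (nat \<Rightarrow> 'a) set) \<in> sets uniform_bernoulli" for n
    by (intro sets.finite_UN sets_repeats) auto
  have "AE w :: nat \<Rightarrow> 'a in uniform_bernoulli. \<exists>n\<ge>N. \<exists>l<n. w \<in> repeats (m n) l n" for N
  proof -
    define Z where "Z = {w :: nat \<Rightarrow> 'a. \<forall>n\<ge>N. \<forall>l<n. w \<notin> repeats (m n) l n}"
    have Z: "Z \<in> sets uniform_bernoulli"
    proof -
      have "Z = space uniform_bernoulli - (\<Union>n\<in>{N..}. \<Union>l\<in>{..<n}. repeats (m n) l n)"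
        by (auto simp: Z_def)
      also have "\<dots> \<in> sets uniform_bernoulli"
        by (intro sets.Diff sets.top sets.countable_UN'' U) auto
      finally show ?thesis .
    qed
    have "measure uniform_bernoulli Z \<le> 0 + e" if "0 < e" for e
    proof -
      obtain K where K: "16 / e < sum g {N..<K}"
        using not_summable_sum_unbounded[OF g(2,1)] by blast
      have "0 < 16 / e" using that by simp
      then have pos: "0 < sum g {N..<K}" using K by linarith
      have "measure uniform_bernoulli Z
          \<le> measure uniform_bernoulli {w :: nat \<Rightarrow> 'a. \<forall>n\<in>{N..<K}. \<forall>l<n. w \<notin> repeats (m n) l n}"
      proof (rule bern.finite_measure_mono)
        have "{w :: nat \<Rightarrow> 'a. \<forall>n\<in>{N..<K}. \<forall>l<n. w \<notin> repeats (m n) l n}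
            = space uniform_bernoulli - (\<Union>n\<in>{N..<K}. \<Union>l\<in>{..<n}. repeats (m n) l n)" by auto
        also have "\<dots> \<in> sets uniform_bernoulli"
          by (intro sets.Diff sets.top sets.countable_UN'' U) auto
        finally show "{w :: nat \<Rightarrow> 'a. \<forall>n\<in>{N..<K}. \<forall>l<n. w \<notin> repeats (m n) l n} \<in> sets uniform_bernoulli" .
      qed (auto simp: Z_def)
      also have "\<dots> \<le> 16 / sum g {N..<K}"
        by (rule prob_no_repeats_le[OF A _ pos]) (simp add: g_def)
      also have "\<dots> \<le> e" using K pos that by (simp add: field_simps)
      finally show ?thesis by simp
    qed
    then have "measure uniform_bernoulli Z \<le> 0" by (rule field_le_epsilon)
    then have "emeasure uniform_bernoulli Z = 0"
      by (simp add: bern.emeasure_eq_measure measure_le_0_iff)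
    then show ?thesis
      using Z by (intro AE_I[of _ _ Z]) (auto simp: Z_def)
  qed
  then show ?thesis by (simp add: AE_all_countable)
qed

subsection \<open>The divergence part\<close>

text \<open>Finiteness means that some finite subset of \<open>C\<close> contains all solutions, and
  a countable set has only countably many finite subsets.\<close>

lemma sets_Collect_infinite:
  assumes "countable C" and meas: "\<And>r. r \<in> C \<Longrightarrow> {x \<in> space M. P r x} \<in> sets M"
  shows "{x \<in> space M. infinite {r \<in> C. P r x}} \<in> sets M"
proof -
  define \<F> where "\<F> = {F. finite F \<and> F \<subseteq> C}"
  have "countable \<F>" unfolding \<F>_def using assms(1) by (rule countable_Collect_finite_subset)
  have "finite {r \<in> C. P r x} \<longleftrightarrow> (\<exists>F\<in>\<F>. \<forall>r\<in>C - F. \<not> P r x)" for x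
  proof
    assume "finite {r \<in> C. P r x}"
    then show "\<exists>F\<in>\<F>. \<forall>r\<in>C - F. \<not> P r x" by (intro bexI[of _ "{r \<in> C. P r x}"]) (auto simp: \<F>_def)
  next
    assume "\<exists>F\<in>\<F>. \<forall>r\<in>C - F. \<not> P r x"
    then obtain F where "finite F" "{r \<in> C. P r x} \<subseteq> F" by (auto simp: \<F>_def)
    then show "finite {r \<in> C. P r x}" by (rule finite_subset[rotated])
  qed
  then have "{x \<in> space M. infinite {r \<in> C. P r x}}
      = space M - (\<Union>F\<in>\<F>. space M - (\<Union>r\<in>C - F. {x \<in> space M. P r x}))"
    by auto
  also have "\<dots> \<in> sets M"
    using assms(1) \<open>countable \<F>\<close>
    by (intro sets.Diff sets.top sets.countable_UN'' meas) auto
  finally show ?thesis .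
qed

lemma countable_rational_points: "countable (rational_points :: (real ^ 'n::finite) set)"
proof -
  have "rational_points \<subseteq> (vec_lambda ` PiE UNIV (\<lambda>_. \<rat>) :: (real ^ 'n) set)"
    by (auto simp: rational_points_def intro!: image_eqI[of _ _ "vec_nth _"])
  moreover have "countable (PiE (UNIV :: 'n set) (\<lambda>_. \<rat> :: real set))"
    by (intro countable_PiE) (auto simp: countable_rat)
  ultimately show ?thesis by (meson countable_image countable_subset)
qed

context integer_ifs
begin

lemma measurable_coding [measurable]: "cod \<in> borel_measurable uniform_bernoulli"
proof -
  have "(\<lambda>w. p (w n)) \<in> borel_measurable uniform_bernoulli" for n
    by (rule measurable_compose[OF measurable_coordinate]) simp
  then have "(\<lambda>w. \<Sum>n. p (w n) /\<^sub>R real q ^ Suc n) \<in> borel_measurable uniform_bernoulli"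
    by (intro borel_measurable_suminf borel_measurable_scaleR borel_measurable_const)
  then show ?thesis by (simp add: coding_map_def[abs_def])
qed

lemma self_similar_measure_eq: "self_similar_measure q p = distr uniform_bernoulli borel cod"
  by (simp add: self_similar_measure_def uniform_bernoulli_def)

section \<open>Atoms of the self-similar measure\<close>

definition atom_mass :: "real ^ 'd \<Rightarrow> real" where
  "atom_mass x = measure uniform_bernoulli {w. cod w = x}"

lemma sets_coding_eq: "{w. cod w = x} \<in> sets uniform_bernoulli"
  using measurable_sets[OF measurable_coding, of "{x}"] by (simp add: vimage_def)

text \<open>Self-similarity at a single point: prepending a random letter to an independent sequence
  preserves the measure, and the preimage of \<open>x\<close> under the map of digit
  \<open>a\<close> is \<open>q x - p a\<close>.\<close>

lemma atom_mass_refine: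
  "atom_mass x = (\<Sum>a\<in>UNIV. atom_mass (real q *\<^sub>R x - p a)) / CARD('a)"
proof -
  let ?L = "measure_pmf (pmf_of_set (UNIV :: 'a set))" and ?B = "uniform_bernoulli :: (nat \<Rightarrow> 'a) measure"
  let ?c = "\<lambda>(a, w :: nat \<Rightarrow> 'a). case_nat a w"
  have iter: "distr (?L \<Otimes>\<^sub>M ?B) ?B ?c = ?B"
    unfolding uniform_bernoulli_def by (rule letters.PiM_iter)
  have mc: "?c \<in> measurable (?L \<Otimes>\<^sub>M ?B) ?B"
    unfolding uniform_bernoulli_def by measurable
  have slice: "{a} \<times> {w. cod w = real q *\<^sub>R x - p a} \<in> sets (?L \<Otimes>\<^sub>M ?B)" for a
    by (intro pair_measureI sets_coding_eq) simp
  have "cod (case_nat a w) = x \<longleftrightarrow> cod w = real q *\<^sub>R x - p a" for a w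
    using coding_step[of "case_nat a w"] ifs_map_step[of x a "cod w"] by auto
  then have vim: "?c -` {w. cod w = x} \<inter> space (?L \<Otimes>\<^sub>M ?B) = (\<Union>a. {a} \<times> {w. cod w = real q *\<^sub>R x - p a})"
    by (auto simp: space_pair_measure)
  have "emeasure ?B {w. cod w = x} = emeasure (distr (?L \<Otimes>\<^sub>M ?B) ?B ?c) {w. cod w = x}"
    by (simp only: iter)
  also have "\<dots> = emeasure (?L \<Otimes>\<^sub>M ?B) (\<Union>a. {a} \<times> {w. cod w = real q *\<^sub>R x - p a})"
    by (simp only: emeasure_distr[OF mc sets_coding_eq] vim)
  also have "\<dots> = (\<Sum>a\<in>UNIV. emeasure (?L \<Otimes>\<^sub>M ?B) ({a} \<times> {w. cod w = real q *\<^sub>R x - p a}))"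
    using slice by (intro sum_emeasure[symmetric]) (auto simp: disjoint_family_on_def)
  also have "\<dots> = (\<Sum>a\<in>UNIV. emeasure ?L {a} * emeasure ?B {w. cod w = real q *\<^sub>R x - p a})"
    by (intro sum.cong refl bern.emeasure_pair_measure_Times sets_coding_eq) simp
  also have "\<dots> = (\<Sum>a\<in>UNIV. ennreal (1 / CARD('a) * atom_mass (real q *\<^sub>R x - p a)))"
    by (intro sum.cong refl)
      (simp add: emeasure_pmf_single bern.emeasure_eq_measure atom_mass_def flip: ennreal_mult)
  also have "\<dots> = ennreal (\<Sum>a\<in>UNIV. 1 / CARD('a) * atom_mass (real q *\<^sub>R x - p a))"
    by (intro sum_ennreal) (simp add: atom_mass_def)
  finally have "ennreal (atom_mass x) = ennreal (\<Sum>a\<in>UNIV. 1 / CARD('a) * atom_mass (real q *\<^sub>R x - p a))"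
    by (simp add: atom_mass_def bern.emeasure_eq_measure)
  then have "atom_mass x = (\<Sum>a\<in>UNIV. 1 / CARD('a) * atom_mass (real q *\<^sub>R x - p a))"
    by (subst (asm) ennreal_inj) (auto simp: atom_mass_def intro!: sum_nonneg)
  then show ?thesis by (simp add: sum_divide_distrib)
qed

lemma finite_large_atoms:
  assumes "0 < c" shows "finite {x. c \<le> atom_mass x}"
proof (rule ccontr)
  assume "infinite {x. c \<le> atom_mass x}"
  then obtain F where F: "F \<subseteq> {x. c \<le> atom_mass x}" "finite F" "card F = Suc (nat \<lceil>1 / c\<rceil>)"
    using infinite_arbitrarily_large by blast
  have "real (card F) * c \<le> (\<Sum>x\<in>F. atom_mass x)"
    using F(1) by (intro sum_bounded_below[where 'a=real, simplified]) auto
  also have "\<dots> = measure uniform_bernoulli (\<Union>x\<in>F. {w. cod w = x})"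
    unfolding atom_mass_def using F(2) sets_coding_eq
    by (intro bern.finite_measure_finite_Union[symmetric]) (auto simp: disjoint_family_on_def)
  also have "\<dots> \<le> 1" by (rule bern.prob_le_1)
  finally have "real (card F) \<le> 1 / c" using \<open>0 < c\<close> by (simp add: field_simps)
  moreover have "1 / c < real (card F)" unfolding F(3) using \<open>0 < c\<close> by linarith
  ultimately show False by simp
qed

text \<open>The set of atoms of maximal mass is finite and mapped into itself by every \<open>x \<mapsto> q x - p a\<close>. Two
  different digits provide two such atoms, and then the expansion enlarges the diameter.\<close>

lemma atom_mass_eq_0:
  assumes pab: "p a \<noteq> p b" shows "atom_mass x = 0"
proof (rule ccontr)
  assume "atom_mass x \<noteq> 0"
  then have pos: "0 < atom_mass x" by (simp add: atom_mass_def less_le)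
  define M where "M = Max (atom_mass ` {y. atom_mass x \<le> atom_mass y})"
  have fin: "finite (atom_mass ` {y. atom_mass x \<le> atom_mass y})"
    using finite_large_atoms[OF pos] by simp
  have "M \<in> atom_mass ` {y. atom_mass x \<le> atom_mass y}"
    unfolding M_def by (rule Max_in[OF fin]) auto
  then obtain y0 where y0: "atom_mass y0 = M" "atom_mass x \<le> M" by auto
  have le_M: "atom_mass y \<le> M" for y
  proof (cases "atom_mass x \<le> atom_mass y")
    case True
    then show ?thesis unfolding M_def by (intro Max_ge[OF fin]) auto
  qed (use y0(2) in simp)
  define T where "T = {y. atom_mass y = M}"
  have "finite T" unfolding T_def
    by (rule finite_subset[OF _ finite_large_atoms[of M]]) (use y0 pos in auto)
  have step: "real q *\<^sub>R y - p c \<in> T" if "y \<in> T" for y c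
  proof -
    \<comment> \<open>The maximal mass \<open>M\<close> is the average of the masses at the images,
      none of which exceeds \<open>M\<close>; hence all of them equal \<open>M\<close>.\<close>
    have "(\<Sum>c\<in>UNIV. M - atom_mass (real q *\<^sub>R y - p c)) = 0"
      using that atom_mass_refine[of y] by (simp add: T_def sum_subtractf field_simps)
    then have "M - atom_mass (real q *\<^sub>R y - p c) = 0"
      using le_M by (subst (asm) sum_nonneg_eq_0_iff) auto
    then show ?thesis by (simp add: T_def)
  qed
  have "compact T" using \<open>finite T\<close> by (rule finite_imp_compact)
  moreover have "y0 \<in> T" using y0 by (simp add: T_def)
  ultimately obtain y z where yz: "y \<in> T" "z \<in> T" "dist y z = diameter T"
    using diameter_compact_attained by blast
  have le_diam: "dist u v \<le> dist y z" if "u \<in> T" "v \<in> T" for u v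
    unfolding yz(3) using \<open>compact T\<close> that compact_imp_bounded diameter_bounded_bound by blast
  have "0 < dist (real q *\<^sub>R y0 - p a) (real q *\<^sub>R y0 - p b)" using pab by simp
  then have "0 < dist y z" using le_diam[OF step step, OF \<open>y0 \<in> T\<close> \<open>y0 \<in> T\<close>, of a b] by linarith
  have "real q * dist y z = dist (real q *\<^sub>R y - p a) (real q *\<^sub>R z - p a)"
  proof -
    have "(real q *\<^sub>R y - p a) - (real q *\<^sub>R z - p a) = real q *\<^sub>R (y - z)"
      by (simp add: algebra_simps)
    then show ?thesis by (simp only: dist_norm) simp
  qed
  also have "\<dots> \<le> 1 * dist y z" using le_diam step yz by simp
  finally show False using q_ge \<open>0 < dist y z\<close> by (simp only: mult_le_cancel_right) auto
qed

lemma AE_coding_irrational: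
  assumes "p a \<noteq> p b" shows "AE w in uniform_bernoulli. cod w \<notin> rational_points"
proof -
  have "AE w in uniform_bernoulli. \<forall>r\<in>rational_points. cod w \<noteq> r"
  proof (subst AE_ball_countable[OF countable_rational_points], intro ballI)
    fix r :: "real ^ 'd"
    have "emeasure uniform_bernoulli {w. cod w = r} = 0"
      using atom_mass_eq_0[OF assms, of r] by (simp add: atom_mass_def bern.emeasure_eq_measure)
    then show "AE w in uniform_bernoulli. cod w \<noteq> r"
      using sets_coding_eq by (intro AE_I[of _ _ "{w. cod w = r}"]) auto
  qed
  then show ?thesis by eventually_elim blast
qed

text \<open>From position \<open>n\<close> on, both sequences copy the letter \<open>n - l\<close>
  places back. Strong induction handles lengths \<open>m\<close> exceeding the period.\<close>

lemma ev_periodic_agree: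
  assumes "l < n" "w \<in> repeats m l n"
  shows "i < n + m \<Longrightarrow> ev_periodic (map w [0..<n]) l i = w i"
proof (induction i rule: less_induct)
  case (less i)
  show ?case
  proof (cases "i < n")
    case True
    then show ?thesis using \<open>l < n\<close> by (auto simp: ev_periodic_def)
  next
    case False
    define k where "k = i - n"
    have i: "i = k + n" "k < m" using False less.prems by (auto simp: k_def)
    have "ev_periodic (map w [0..<n]) l i = ev_periodic (map w [0..<n]) l (k + l)"
      using ev_periodic_shift[of l "map w [0..<n]" k] \<open>l < n\<close> i by simp
    also have "\<dots> = w (k + l)" using i \<open>l < n\<close> by (intro less.IH) auto
    also have "\<dots> = w i" using assms(2) i by (auto simp: repeats_def add.commute)
    finally show ?thesis .
  qed
qed

end

context intrinsic_approximation
begin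

lemma sets_W_star: "W_star q p \<Psi> \<in> sets borel"
proof -
  define C where "C = range cod \<inter> rational_points"
  have "countable C" unfolding C_def using countable_rational_points by (rule countable_Int2)
  then have "{x \<in> space borel. infinite {r \<in> C. norm (x - r) < \<Psi> (q_int q p r)}} \<in> sets borel"
    by (rule sets_Collect_infinite) measurable
  moreover have "range cod \<in> sets borel"
    using compact_range_coding compact_imp_closed borel_closed by blast
  ultimately have "range cod \<inter> {x \<in> space borel. infinite {r \<in> C. norm (x - r) < \<Psi> (q_int q p r)}} \<in> sets borel"
    by (intro sets.Int)
  also have "range cod \<inter> {x \<in> space borel. infinite {r \<in> C. norm (x - r) < \<Psi> (q_int q p r)}} = W_star q p \<Psi>"
    by (auto simp: W_star_def C_def self_similar_set_eq)
  finally show ?thesis .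
qed

text \<open>Infinitely many lengths \<open>n\<close> might yield the same rational point; this is excluded because an
  irrational point keeps a positive distance from any finite set of rational ones.\<close>

lemma irrational_mem_W_star:
  assumes irr: "cod w \<notin> rational_points"
    and rep: "\<And>N. \<exists>n\<ge>N. \<exists>l<n. w \<in> repeats (m n) l n"
    and m: "\<And>n. (2 * bnd + 1) / real q ^ (n + m n) < \<Psi> (q ^ n)"
  shows "cod w \<in> W_star q p \<Psi>"
proof -
  define R where "R = {r \<in> range cod \<inter> rational_points. norm (cod w - r) < \<Psi> (q_int q p r)}"
  have close: "\<exists>r\<in>R. norm (cod w - r) < \<epsilon>" if "0 < \<epsilon>" for \<epsilon>
  proof -
    have "(\<lambda>n. (2 * bnd) * (1 / real q) ^ n) \<longlonglongrightarrow> (2 * bnd) * 0"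
      using q_ge by (intro tendsto_mult tendsto_const LIMSEQ_power_zero) auto
    then have "\<forall>\<^sub>F n in sequentially. (2 * bnd) * (1 / real q) ^ n < \<epsilon>"
      using that by (intro order_tendstoD(2)[of _ 0]) auto
    then obtain N where N: "\<And>n. n \<ge> N \<Longrightarrow> 2 * bnd / real q ^ n < \<epsilon>"
      by (auto simp: eventually_sequentially power_divide)
    obtain n l where nl: "n \<ge> N" "l < n" "w \<in> repeats (m n) l n" using rep by blast
    define v where "v = ev_periodic (map w [0..<n]) l"
    have agree: "norm (cod w - cod v) \<le> 2 * bnd / real q ^ (n + m n)"
      unfolding v_def using ev_periodic_agree[OF nl(2,3)] by (intro coding_agree) simp
    have rat: "cod v \<in> range cod" "cod v \<in> rational_points"
      unfolding v_def using nl(2) by (auto intro!: coding_ev_periodic_rational)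
    have "1 \<le> q_int q p (cod v)" by (rule q_int_pos[OF rat])
    moreover have "q_int q p (cod v) \<le> q ^ n"
      unfolding v_def using q_int_le[of l "map w [0..<n]"] nl(2) by simp
    \<comment> \<open>A shorter code of the same point may exist, but a smaller intrinsic
      denominator only enlarges the admissible radius.\<close>
    ultimately have "\<Psi> (q ^ n) \<le> \<Psi> (q_int q p (cod v))" by (rule Psi_le)
    moreover have "2 * bnd / real q ^ (n + m n) \<le> (2 * bnd + 1) / real q ^ (n + m n)"
      by (intro divide_right_mono) auto
    ultimately have "cod v \<in> R"
      using agree m[of n] rat by (auto simp: R_def)
    moreover have "norm (cod w - cod v) < \<epsilon>"
      using agree N[of "n + m n"] nl(1) by linarith
    ultimately show ?thesis by blast
  qed
  have "infinite R"
  proof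
    assume "finite R"
    define \<epsilon> where "\<epsilon> = Min (insert 1 ((\<lambda>r. norm (cod w - r)) ` R))"
    have "0 < \<epsilon>"
      unfolding \<epsilon>_def using \<open>finite R\<close> irr by (subst Min_gr_iff) (auto simp: R_def)
    then obtain r where "r \<in> R" "norm (cod w - r) < \<epsilon>" using close by blast
    moreover have "\<epsilon> \<le> norm (cod w - r)"
      unfolding \<epsilon>_def using \<open>finite R\<close> \<open>r \<in> R\<close> by (intro Min_le) auto
    ultimately show False by simp
  qed
  then show ?thesis by (simp add: W_star_def R_def self_similar_set_eq)
qed

text \<open>The exponent is chosen so that raising \<open>q\<close> to it gives
  \<open>CARD('a)\<close>; it converts length scales into numbers of words.\<close>

lemma power_power_dimension:
  assumes "0 < x" shows "(real q ^ k * x) powr (ln (CARD('a)) / ln q) = real CARD('a) ^ k * x powr (ln (CARD('a)) / ln q)"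
proof -
  have "ln (real q) \<noteq> 0" using q_ge by simp
  then have "real q powr (ln (CARD('a)) / ln q) = CARD('a)"
    using q_pos by (simp add: powr_def)
  then have "(real q ^ k) powr (ln (CARD('a)) / ln q) = real CARD('a) ^ k"
    using q_pos by (simp add: powr_power flip: powr_realpow) (metis mult.commute powr_powr powr_realpow zero_less_card_finite of_nat_0_less_iff)
  then show ?thesis using assms q_pos by (simp add: powr_mult)
qed

text \<open>If all digits coincide, the attractor is a point and \<open>W_star\<close> is empty.
  Distinct digits exclude this, rule out atoms and force at least two letters.\<close>

theorem self_similar_measure_W_star_eq_1:
  assumes pab: "p a \<noteq> p b"
    and div: "\<not> summable (\<lambda>n. real n * real CARD('a) ^ n * \<Psi> (q ^ n) powr (ln (CARD('a)) / ln q))"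
  shows "emeasure (self_similar_measure q p) (W_star q p \<Psi>) = 1"
proof -
  define s where "s = ln (CARD('a)) / ln q"
  define A where "A = real CARD('a)"
  define f where "f n = real n * A ^ n * \<Psi> (q ^ n) powr s" for n
  \<comment> \<open>\<open>2 * bnd\<close> is the constant of \<open>coding_agree\<close>; adding 1
    makes \<open>C\<close> visibly positive.\<close>
  define C where "C = 2 * bnd + 1"
  have "a \<noteq> b" using pab by auto
  then have card2: "CARD('a) \<ge> 2" using card_mono[of UNIV "{a, b}"] by simp
  have A: "2 \<le> A" using card2 by (simp add: A_def)
  have s: "0 \<le> s" using card2 q_ge by (simp add: s_def)
  have C: "0 < C" using bnd_nonneg by (simp add: C_def)
  \<comment> \<open>A zero of \<open>\<Psi>\<close> at some \<open>q ^ n\<close> would persist by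
    monotonicity and leave only finitely many nonzero terms.\<close>
  have Psi_pos: "0 < \<Psi> (q ^ n)" for n
  proof (rule ccontr)
    assume "\<not> 0 < \<Psi> (q ^ n)"
    then have "\<Psi> (q ^ k) = 0" if "n \<le> k" for k
      using Psi_power_nonneg[of k] Psi_le[of "q ^ n" "q ^ k"] q_ge that power_increasing[of n k q] by fastforce
    then have "f k = 0" if "n \<le> k" for k using that by (simp add: f_def)
    then have "summable f" by (intro summable_finite[of "{..<n}"]) auto
    then show False using div by (simp add: f_def[abs_def] A_def s_def)
  qed
  have ex: "\<exists>m. C / real q ^ (n + m) < \<Psi> (q ^ n)" for n
  proof -
    have "(\<lambda>m. (C / real q ^ n) * (1 / real q) ^ m) \<longlonglongrightarrow> (C / real q ^ n) * 0"
      using q_ge by (intro tendsto_mult tendsto_const LIMSEQ_power_zero) auto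
    then have "\<forall>\<^sub>F m in sequentially. (C / real q ^ n) * (1 / real q) ^ m < \<Psi> (q ^ n)"
      using Psi_pos by (intro order_tendstoD(2)[of _ 0]) auto
    then show ?thesis by (auto simp: eventually_sequentially power_add power_divide)
  qed
  define m where "m n = (LEAST m. C / real q ^ (n + m) < \<Psi> (q ^ n))" for n
  have m: "C / real q ^ (n + m n) < \<Psi> (q ^ n)" for n
    unfolding m_def by (rule LeastI_ex[OF ex])
  have m_least: "\<Psi> (q ^ n) \<le> C / real q ^ (n + (m n - 1))" if "m n \<noteq> 0" for n
    using that not_less_Least[of "m n - 1" "\<lambda>k. C / real q ^ (n + k) < \<Psi> (q ^ n)"]
    by (simp add: m_def[symmetric] not_less)
  \<comment> \<open>Minimality gives the reverse inequality one step earlier, at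
    \<open>m n - 1\<close>; that lost step accounts for the factor \<open>A\<close>.\<close>
  have f_le: "f n \<le> C powr s * A * (real n * (1 / A) ^ m n)" if "m n \<noteq> 0" for n
  proof -
    define k where "k = m n - 1"
    have k: "m n = Suc k" using that by (simp add: k_def)
    have "real q ^ (n + k) * \<Psi> (q ^ n) \<le> C"
      using m_least[OF that] q_pos unfolding k_def[symmetric] by (simp add: pos_le_divide_eq mult.commute)
    then have "(real q ^ (n + k) * \<Psi> (q ^ n)) powr s \<le> C powr s"
      using s Psi_pos[of n] q_pos by (intro powr_mono2) auto
    then have "A ^ (n + k) * \<Psi> (q ^ n) powr s \<le> C powr s"
      using power_power_dimension[OF Psi_pos[of n], of "n + k"] by (simp add: A_def s_def)
    then have "A ^ n * \<Psi> (q ^ n) powr s \<le> C powr s * (1 / A) ^ k"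
      using A by (simp add: power_add field_simps)
    then have "real n * (A ^ n * \<Psi> (q ^ n) powr s) \<le> real n * (C powr s * (1 / A) ^ k)"
      by (intro mult_left_mono) auto
    then show ?thesis using A by (simp add: f_def k field_simps)
  qed
  have "\<not> summable (\<lambda>n. real n * (1 / A) ^ m n)"
  proof
    assume sm: "summable (\<lambda>n. real n * (1 / A) ^ m n)"
    \<comment> \<open>Where \<open>m n = 0\<close> the term is \<open>n\<close>, so convergence
      excludes this for large \<open>n\<close>, and \<open>f_le\<close> applies from there
      on.\<close>
    have "\<forall>\<^sub>F n in sequentially. real n * (1 / A) ^ m n < 1"
      using order_tendstoD(2)[OF summable_LIMSEQ_zero[OF sm]] by simp
    then have ev: "\<forall>\<^sub>F n in sequentially. norm (f n) \<le> C powr s * A * (real n * (1 / A) ^ m n)"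
      using eventually_ge_at_top[of 1]
    proof eventually_elim
      case (elim n)
      then have "m n \<noteq> 0" by (intro notI) simp
      then show ?case using f_le[of n] A by (simp add: f_def)
    qed
    have "summable f"
      by (rule summable_comparison_test_ev[OF ev]) (intro summable_mult sm)
    then show False using div by (simp add: f_def[abs_def] A_def s_def)
  qed
  then have "AE w :: nat \<Rightarrow> 'a in uniform_bernoulli. \<forall>N. \<exists>n\<ge>N. \<exists>l<n. w \<in> repeats (m n) l n"
    using AE_infinitely_many_repeats[OF card2, of m] by (simp add: A_def)
  then have "AE w in uniform_bernoulli. cod w \<in> W_star q p \<Psi>"
    using AE_coding_irrational[OF pab]
  proof eventually_elim
    case (elim w)
    show ?case
      using elim m by (intro irrational_mem_W_star[of w m]) (auto simp: C_def)
  qed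
  moreover have "emeasure (self_similar_measure q p) (W_star q p \<Psi>)
      = emeasure uniform_bernoulli {w \<in> space uniform_bernoulli. cod w \<in> W_star q p \<Psi>}"
    unfolding self_similar_measure_eq
    by (subst emeasure_distr[OF measurable_coding sets_W_star]) (simp add: vimage_def)
  moreover have "{w. cod w \<in> W_star q p \<Psi>} \<in> sets uniform_bernoulli"
    using measurable_sets[OF measurable_coding sets_W_star] by (simp add: vimage_def)
  ultimately show ?thesis
    by (simp add: bern.emeasure_eq_1_AE)
qed

end

theorem theorem2p3:
  fixes q :: nat
    and p :: "'a::finite \<Rightarrow> real ^ 'd::finite"
    and \<Psi> :: "nat \<Rightarrow> real"
  assumes "q \<ge> 2"
    and "\<And>a i. p a $ i \<in> \<int>"
    and "\<And>n. n \<ge> 1 \<Longrightarrow> \<Psi> n \<ge> 0"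
    and "antimono_on {1..} \<Psi>"
  shows "(\<forall>s\<ge>0. summable (\<lambda>n. real n * real CARD('a) ^ n * \<Psi> (q ^ n) powr s)
            \<longrightarrow> hausdorff_measure s (W_star q p \<Psi>) = 0)
       \<and> ((\<exists>a b. p a \<noteq> p b)
            \<longrightarrow> \<not> summable (\<lambda>n. real n * real CARD('a) ^ n
                     * \<Psi> (q ^ n) powr (ln (real CARD('a)) / ln (real q)))
            \<longrightarrow> emeasure (self_similar_measure q p) (W_star q p \<Psi>) = 1)"
proof -
  interpret intrinsic_approximation q p \<Psi>
    using assms by unfold_locales
  show ?thesis
    using hausdorff_measure_W_star_eq_0 self_similar_measure_W_star_eq_1 by blast
qed

end
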